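(* Let $(\Gamma,S)$ be a finite Coxeter system. Let $\mathbf r$ and $\mathbf r'$ be two sets of positive rates on $S$ with $r_s\le r'_s$ for all $s\in S$. Let $t>0$. Denote the corresponding transition probabilities by $p_t(x,y;\mathbf r)$ and $p_t(x,y;\mathbf r')$. Then $p_t(o,\cdot;\mathbf r)$ majorizes $p_t(o,\cdot;\mathbf r')$, with inequality if $\mathbf r\ne\mathbf r'$ (that is, if $\mathbf r\neq\mathbf r'$, then the decreasing rearrangements of the two probability vectors are not equal).
   Context: A Coxeter system $(\Gamma,S)$ is a group $\Gamma$ with generating set $S$ given by a presentation $\langle S\mid (ss')^{m(s,s')}\ \forall s,s'\in S\rangle$ where each $m(s,s')=m(s',s)$ is a positive integer or $\infty$ (no relation if $\infty$), $m(s,s)=1$, and $m(s,s')\ge 2$ for $s\ne s'$. It is finite if $\Gamma$ is finite. $o$ denotes the identity element. The random walk with rates $\mathbf r=(r_s)_{s\in S}$, $r_s>0$, is the continuous-time Markov chain on $\Gamma$ that jumps from $x$ to $xs$ at rate $r_s$ for each $s\in S$; $p_t(x,y;\mathbf r)$ is the probability of being at $y$ at time $t$ when started from $x$. For vectors $f,g$ of length $n$ with decreasing rearrangements $f_{[1]}\ge\dots\ge f_{[n]}$ and $g_{[1]}\ge\dots\ge g_{[n]}$, $f$ majorizes $g$ if $f_{[1]}+\dots+f_{[i]}\ge g_{[1]}+\dots+g_{[i]}$ for each $i$, with equality when $i=n$. *)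

theory Defs
  imports
    "HOL-Algebra.Generated_Groups"
    "HOL-Library.Extended_Nat"
    "HOL-Probability.Probability"
begin

section \<open>Presentations and Coxeter systems\<close>

text \<open>
  A word over the letters \<open>s\<close> and \<open>s\<inverse>\<close> with \<open>s \<in> S\<close> is a list of pairs:
  \<open>(s, True)\<close> stands for \<open>s\<close> and \<open>(s, False)\<close> for \<open>s\<inverse>\<close>.
  The group \<open>\<langle>S | R\<rangle>\<close> is the set of words modulo the equivalence relation generated by
  deleting subwords \<open>ss\<inverse>\<close>, \<open>s\<inverse>s\<close> and relators \<open>w \<in> R\<close>.
\<close>

type_synonym 'a word = "('a \<times> bool) list"

definition words :: "'a set \<Rightarrow> 'a word set" where
  "words S = lists (S \<times> UNIV)"

inductive deletes :: "'a set \<Rightarrow> 'a word set \<Rightarrow> 'a word \<Rightarrow> 'a word \<Rightarrow> bool"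
  for S :: "'a set" and R :: "'a word set" where
  cancel: "\<lbrakk>u \<in> words S; v \<in> words S; s \<in> S\<rbrakk> \<Longrightarrow> deletes S R (u @ [(s, b), (s, \<not> b)] @ v) (u @ v)"
| relator: "\<lbrakk>u \<in> words S; v \<in> words S; w \<in> R\<rbrakk> \<Longrightarrow> deletes S R (u @ w @ v) (u @ v)"

definition word_value :: "('a, 'b) monoid_scheme \<Rightarrow> 'a word \<Rightarrow> 'a" where
  "word_value G w = foldr (\<lambda>(s, b) x. (if b then s else inv\<^bsub>G\<^esub> s) \<otimes>\<^bsub>G\<^esub> x) w \<one>\<^bsub>G\<^esub>"

text \<open>
  The last conjunct says that evaluation of words induces a well-defined and injective map
  from \<open>\<langle>S | R\<rangle>\<close> to \<open>G\<close>; it is onto because \<open>S\<close> generates \<open>G\<close>.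
\<close>

definition has_presentation :: "('a, 'b) monoid_scheme \<Rightarrow> 'a set \<Rightarrow> 'a word set \<Rightarrow> bool" where
  "has_presentation G S R \<longleftrightarrow>
     group G \<and> S \<subseteq> carrier G \<and> R \<subseteq> words S \<and> generate G S = carrier G \<and>
     (\<forall>v\<in>words S. \<forall>w\<in>words S.
        word_value G v = word_value G w \<longleftrightarrow> equivclp (deletes S R) v w)"

definition coxeter_relators :: "'a set \<Rightarrow> ('a \<Rightarrow> 'a \<Rightarrow> enat) \<Rightarrow> 'a word set" where
  "coxeter_relators S m =
     {concat (replicate n [(s, True), (s', True)]) | s s' n. s \<in> S \<and> s' \<in> S \<and> m s s' = enat n}"

definition coxeter_system :: "('a, 'b) monoid_scheme \<Rightarrow> 'a set \<Rightarrow> bool" where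
  "coxeter_system G S \<longleftrightarrow>
     (\<exists>m. (\<forall>s\<in>S. m s s = 1) \<and>
          (\<forall>s\<in>S. \<forall>s'\<in>S. m s s' = m s' s) \<and>
          (\<forall>s\<in>S. \<forall>s'\<in>S. s \<noteq> s' \<longrightarrow> 2 \<le> m s s') \<and>
          has_presentation G S (coxeter_relators S m))"


section \<open>The continuous-time random walk\<close>

text \<open>
  The walk is built from its jump chain and holding times, for a finite group \<open>G\<close>.
  With \<open>q = (\<Sum>s\<in>S. r s)\<close>, the holding times are independent and exponential of rate \<open>q\<close>, and
  independently of them each jump is a right multiplication by \<open>s \<in> S\<close> with probability \<open>r s / q\<close>;
  hence the jump rate from \<open>x\<close> to \<open>x s\<close> is \<open>q * (r s / q) = r s\<close>.
  A sample point \<open>\<omega>\<close> gives for each \<open>n\<close> an exponential time \<open>fst (\<omega> n)\<close> of rate 1 and the increment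
  \<open>snd (\<omega> n)\<close> of the jump number \<open>n\<close> (counted from 0); the holding time before that jump
  is \<open>fst (\<omega> n) / q\<close>, to be read as infinite if \<open>q = 0\<close>, that is, if \<open>S = {}\<close>.
\<close>

definition increment_prob :: "('a, 'b) monoid_scheme \<Rightarrow> 'a set \<Rightarrow> ('a \<Rightarrow> real) \<Rightarrow> 'a \<Rightarrow> real" where
  "increment_prob G S r g =
     (if S = {} then (if g = \<one>\<^bsub>G\<^esub> then 1 else 0)
      else if g \<in> S then r g / (\<Sum>s\<in>S. r s) else 0)"

text \<open>
  The increments live on the finite set \<open>carrier G\<close>, not on the whole type, which may be uncountable:
  with the latter the event that the walk is at \<open>y\<close> could fail to be measurable.
\<close>

definition walk_space ::
    "('a, 'b) monoid_scheme \<Rightarrow> 'a set \<Rightarrow> ('a \<Rightarrow> real) \<Rightarrow> (nat \<Rightarrow> real \<times> 'a) measure" where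
  "walk_space G S r =
     (\<Pi>\<^sub>M n\<in>UNIV. density lborel (exponential_density 1) \<Otimes>\<^sub>M
                  point_measure (carrier G) (increment_prob G S r))"

text \<open>
  The number of jumps up to time \<open>t\<close>. The set of such jumps is almost surely finite.
\<close>

definition num_jumps :: "'a set \<Rightarrow> ('a \<Rightarrow> real) \<Rightarrow> real \<Rightarrow> (nat \<Rightarrow> real \<times> 'a) \<Rightarrow> nat" where
  "num_jumps S r t \<omega> = card {n. (\<Sum>k\<le>n. fst (\<omega> k)) \<le> (\<Sum>s\<in>S. r s) * t}"

definition walk ::
    "('a, 'b) monoid_scheme \<Rightarrow> 'a set \<Rightarrow> ('a \<Rightarrow> real) \<Rightarrow> 'a \<Rightarrow> real \<Rightarrow> (nat \<Rightarrow> real \<times> 'a) \<Rightarrow> 'a" where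
  "walk G S r x t \<omega> = foldl (\<lambda>y n. y \<otimes>\<^bsub>G\<^esub> snd (\<omega> n)) x [0..<num_jumps S r t \<omega>]"

definition transition_prob ::
    "('a, 'b) monoid_scheme \<Rightarrow> 'a set \<Rightarrow> ('a \<Rightarrow> real) \<Rightarrow> real \<Rightarrow> 'a \<Rightarrow> 'a \<Rightarrow> real" where
  "transition_prob G S r t x y =
     measure (walk_space G S r) {\<omega> \<in> space (walk_space G S r). walk G S r x t \<omega> = y}"


section \<open>Majorization\<close>

text \<open>Vectors are functions on a finite index set \<open>A\<close>.\<close>

definition decreasing_rearrangement :: "'i set \<Rightarrow> ('i \<Rightarrow> real) \<Rightarrow> real list" where
  "decreasing_rearrangement A f = rev (sorted_list_of_multiset (image_mset f (mset_set A)))"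

definition majorizes :: "'i set \<Rightarrow> ('i \<Rightarrow> real) \<Rightarrow> ('i \<Rightarrow> real) \<Rightarrow> bool" where
  "majorizes A f g \<longleftrightarrow>
     (\<forall>i\<in>{1..card A}. (\<Sum>j<i. decreasing_rearrangement A f ! j) \<ge> (\<Sum>j<i. decreasing_rearrangement A g ! j)) \<and>
     (\<Sum>j<card A. decreasing_rearrangement A f ! j) = (\<Sum>j<card A. decreasing_rearrangement A g ! j)"

end

theory Submission
  imports Defs
begin

text \<open>
  Call \<open>f\<close> on the group Bruhat decreasing if \<open>f (t x) \<le> f x\<close> whenever \<open>t\<close> is a reflection and \<open>x\<close>
  lies on the same side of the wall of \<open>t\<close> as the identity. A generator either moves \<open>x\<close> across the
  wall of \<open>t\<close>, and then \<open>x s = t x\<close>, or leaves it on its side. Hence a sufficiently lazy step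
  \<open>f \<mapsto> a f + \<Sum>s. c s * f (\<cdot> s)\<close> preserves Bruhat decreasing functions, and for two such functions the
  increments along an edge have the same sign. So moving weight from \<open>a\<close> to the \<open>c s\<close> decreases the
  pairing of \<open>n\<close> steps of a Bruhat decreasing function with another one. The walk is a
  Poisson mixture of such steps, with any amount of laziness, and for both sets of rates the same
  Poisson parameter can be used. Thus \<open>p\<^sub>t(A)\<close> decreases in the rates when \<open>A\<close> is a
  lower set, and the sums of the \<open>k\<close> largest values of \<open>p\<^sub>t\<close> are attained on lower sets. The maximum
  is attained at the identity, where already the term \<open>n = 1\<close> gives strict inequality.
\<close>

section \<open>Walls and reflections\<close>

text \<open>
  \<open>crosses G t w\<close> says that an odd number of the steps \<open>u \<mapsto> u s\<close> of the path from \<open>\<one>\<close> spelled by \<open>w\<close>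
  satisfy \<open>t = u s u\<inverse>\<close>, in a group in which all generators \<open>s\<close> are involutions. Both signs
  of a letter therefore count alike.
\<close>

fun crosses :: "('a, 'b) monoid_scheme \<Rightarrow> 'a \<Rightarrow> 'a word \<Rightarrow> bool" where
  "crosses G t [] = False"
| "crosses G t ((s, b) # w) = ((t = s) \<noteq> crosses G (s \<otimes>\<^bsub>G\<^esub> t \<otimes>\<^bsub>G\<^esub> s) w)"

lemma word_value_Nil [simp]: "word_value G [] = \<one>\<^bsub>G\<^esub>"
  by (simp add: word_value_def)

lemma word_value_Cons:
  "word_value G ((s, b) # w) = (if b then s else inv\<^bsub>G\<^esub> s) \<otimes>\<^bsub>G\<^esub> word_value G w"
  by (simp add: word_value_def)

lemma words_Nil [simp]: "[] \<in> words S"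
  by (simp add: words_def)

lemma words_Cons [simp]: "(s, b) # w \<in> words S \<longleftrightarrow> s \<in> S \<and> w \<in> words S"
  by (auto simp: words_def)

lemma words_append [simp]: "u @ v \<in> words S \<longleftrightarrow> u \<in> words S \<and> v \<in> words S"
  by (auto simp: words_def)

locale finite_coxeter_system = group G for G (structure) +
  fixes S :: "'a set"
  assumes coxeter: "coxeter_system G S"
    and fin: "finite (carrier G)"
begin

lemma S_subset: "S \<subseteq> carrier G"
  using coxeter by (auto simp: coxeter_system_def has_presentation_def)

lemma S_closed [simp, intro]: "s \<in> S \<Longrightarrow> s \<in> carrier G"
  using S_subset by auto

lemma finite_S: "finite S"
  using S_subset fin finite_subset by blast

lemma word_value_closed [simp, intro]: "w \<in> words S \<Longrightarrow> word_value G w \<in> carrier G"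
  by (induction w) (auto simp: word_value_Cons)

lemma word_value_append:
  "u \<in> words S \<Longrightarrow> v \<in> words S \<Longrightarrow> word_value G (u @ v) = word_value G u \<otimes> word_value G v"
  by (induction u) (auto simp: word_value_Cons m_assoc)

text \<open>\<open>coxeter_system\<close> only asserts that some matrix exists; choosing one fixes
  the set of relators for the whole locale.\<close>

definition coxeter_matrix :: "'a \<Rightarrow> 'a \<Rightarrow> enat" where
  "coxeter_matrix = (SOME m. (\<forall>s\<in>S. m s s = 1) \<and> (\<forall>s\<in>S. \<forall>s'\<in>S. m s s' = m s' s) \<and>
          (\<forall>s\<in>S. \<forall>s'\<in>S. s \<noteq> s' \<longrightarrow> 2 \<le> m s s') \<and> has_presentation G S (coxeter_relators S m))"

lemma coxeter_matrix_diag: "s \<in> S \<Longrightarrow> coxeter_matrix s s = 1"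
  and presentation: "has_presentation G S (coxeter_relators S coxeter_matrix)"
proof -
  let ?m = coxeter_matrix
  have "(\<forall>s\<in>S. ?m s s = 1) \<and> (\<forall>s\<in>S. \<forall>s'\<in>S. ?m s s' = ?m s' s) \<and>
          (\<forall>s\<in>S. \<forall>s'\<in>S. s \<noteq> s' \<longrightarrow> 2 \<le> ?m s s') \<and> has_presentation G S (coxeter_relators S ?m)"
    using someI_ex[OF coxeter[unfolded coxeter_system_def]] unfolding coxeter_matrix_def .
  then show "s \<in> S \<Longrightarrow> ?m s s = 1" and "has_presentation G S (coxeter_relators S ?m)"
    by auto
qed

abbreviation "relators \<equiv> coxeter_relators S coxeter_matrix"

lemma relators_subset: "relators \<subseteq> words S"
  and generate_S: "generate G S = carrier G"
  using presentation by (auto simp: has_presentation_def)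

lemma word_value_eq_iff:
  "v \<in> words S \<Longrightarrow> w \<in> words S \<Longrightarrow>
    word_value G v = word_value G w \<longleftrightarrow> equivclp (deletes S relators) v w"
  using presentation by (auto simp: has_presentation_def)

lemma word_value_relator:
  assumes "w \<in> relators"
  shows "word_value G w = \<one>"
proof -
  have "deletes S relators ([] @ w @ []) ([] @ [])"
    using assms by (intro deletes.relator) auto
  then have "equivclp (deletes S relators) w []"
    by (auto intro: r_into_equivclp)
  then show ?thesis
    using word_value_eq_iff[of w "[]"] assms relators_subset by auto
qed

text \<open>The diagonal exponent 1 makes the word \<open>s s\<close> itself a relator.\<close>

lemma S_square [simp]:
  assumes "s \<in> S"
  shows "s \<otimes> s = \<one>"
proof -
  have "[(s, True), (s, True)] \<in> relators"
    using assms coxeter_matrix_diag[OF assms] unfolding coxeter_relators_def one_enat_def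
    by (auto intro!: exI[of _ s] exI[of _ "Suc 0"])
  from word_value_relator[OF this] show ?thesis
    using assms by (simp add: word_value_Cons)
qed

lemma S_inv [simp]: "s \<in> S \<Longrightarrow> inv s = s"
  using S_square[of s] inv_equality[of s s] by auto

lemma S_square_cancel [simp]: "s \<in> S \<Longrightarrow> x \<in> carrier G \<Longrightarrow> s \<otimes> (s \<otimes> x) = x"
  by (simp flip: m_assoc)

lemma S_square_cancel_right [simp]: "s \<in> S \<Longrightarrow> x \<in> carrier G \<Longrightarrow> (x \<otimes> s) \<otimes> s = x"
  by (simp add: m_assoc)

lemma inv_cancel [simp]:
  assumes "x \<in> carrier G" "y \<in> carrier G"
  shows "inv x \<otimes> (x \<otimes> y) = y" "x \<otimes> (inv x \<otimes> y) = y"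
  using assms by (simp_all flip: m_assoc)

section \<open>Wall crossings as an invariant of the group element\<close>

lemma crosses_append:
  assumes "u \<in> words S" "v \<in> words S" "t \<in> carrier G"
  shows "crosses G t (u @ v) =
    (crosses G t u \<noteq> crosses G (inv (word_value G u) \<otimes> t \<otimes> word_value G u) v)"
  using assms
proof (induction u arbitrary: t)
  case (Cons a u)
  obtain s b where [simp]: "a = (s, b)" by (cases a)
  from Cons.prems have s: "s \<in> S" and u: "u \<in> words S" by auto
  \<comment> \<open>Past a prefix the path continues from the value of that prefix, so the wall is
    seen conjugated; the first letter and the rest of the prefix conjugate in succession.\<close>
  have "inv (s \<otimes> word_value G u) \<otimes> t \<otimes> (s \<otimes> word_value G u) =
      inv (word_value G u) \<otimes> (s \<otimes> t \<otimes> s) \<otimes> word_value G u"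
    using s u Cons.prems by (simp add: inv_mult_group m_assoc)
  then show ?case
    using Cons.IH[of "s \<otimes> t \<otimes> s"] Cons.prems s u by (auto simp: word_value_Cons)
qed auto

text \<open>The path alternates between \<open>s\<close> and \<open>s'\<close>, and its step number
  \<open>i\<close>, counted from 0, crosses the wall of
  \<open>(s \<otimes> s') [^] i \<otimes> s\<close>.\<close>

lemma crosses_power_word:
  assumes "s \<in> S" "s' \<in> S" "t \<in> carrier G"
  shows "crosses G t (concat (replicate n [(s, True), (s', True)])) =
    odd (\<Sum>i<2*n. of_bool (t = (s \<otimes> s') [^] i \<otimes> s) :: nat)"
  using assms(3)
proof (induction n arbitrary: t)
  case (Suc n)
  define d where "d = s \<otimes> s'"
  have d: "d \<in> carrier G" using assms by (simp add: d_def)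
  have inv_d: "inv d = s' \<otimes> s" using assms inv_mult_group[of s s'] by (simp add: d_def)
  have sd: "s \<otimes> inv d = d \<otimes> s" using assms unfolding inv_d by (simp add: d_def m_assoc)
  have t1: "s \<otimes> t \<otimes> s = s' \<longleftrightarrow> t = d [^] Suc 0 \<otimes> s"
  proof -
    have "s \<otimes> t \<otimes> s = s' \<longleftrightarrow> t = s \<otimes> s' \<otimes> s"
    proof
      assume "s \<otimes> t \<otimes> s = s'"
      then have "s \<otimes> (s \<otimes> t \<otimes> s) \<otimes> s = s \<otimes> s' \<otimes> s" by simp
      then show "t = s \<otimes> s' \<otimes> s" using assms Suc.prems by (simp add: m_assoc)
    qed (use assms in \<open>simp add: m_assoc\<close>)
    then show ?thesis using d by (simp add: d_def)
  qed
  \<comment> \<open>Passing two letters conjugates \<open>t\<close> by \<open>d\<close>, which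
    shifts the exponent by two.\<close>
  have t2: "s' \<otimes> (s \<otimes> t \<otimes> s) \<otimes> s' = d [^] i \<otimes> s \<longleftrightarrow> t = d [^] Suc (Suc i) \<otimes> s" for i :: nat
  proof -
    have "s' \<otimes> (s \<otimes> t \<otimes> s) \<otimes> s' = inv d \<otimes> t \<otimes> d"
      unfolding inv_d using assms Suc.prems by (simp add: d_def m_assoc)
    moreover have "inv d \<otimes> t \<otimes> d = d [^] i \<otimes> s \<longleftrightarrow> t = d \<otimes> (d [^] i \<otimes> s) \<otimes> inv d"
    proof
      assume "inv d \<otimes> t \<otimes> d = d [^] i \<otimes> s"
      then have "d \<otimes> (inv d \<otimes> t \<otimes> d) \<otimes> inv d = d \<otimes> (d [^] i \<otimes> s) \<otimes> inv d"
        by simp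
      then show "t = d \<otimes> (d [^] i \<otimes> s) \<otimes> inv d"
        using d Suc.prems by (simp add: m_assoc)
    next
      assume "t = d \<otimes> (d [^] i \<otimes> s) \<otimes> inv d"
      then show "inv d \<otimes> t \<otimes> d = d [^] i \<otimes> s"
        using d assms by (simp add: m_assoc)
    qed
    moreover have "d \<otimes> (d [^] i \<otimes> s) \<otimes> inv d = d [^] Suc (Suc i) \<otimes> s"
    proof -
      have "d \<otimes> (d [^] i \<otimes> s) \<otimes> inv d = (d \<otimes> d [^] i) \<otimes> (s \<otimes> inv d)"
        using d assms by (simp add: m_assoc)
      also have "\<dots> = d [^] Suc (Suc i) \<otimes> s"
        unfolding sd nat_pow_Suc2[OF d, symmetric] using d assms by (simp add: m_assoc)
      finally show ?thesis .
    qed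
    ultimately show ?thesis by metis
  qed
  have "crosses G t (concat (replicate (Suc n) [(s, True), (s', True)])) =
      ((t = s) \<noteq> ((s \<otimes> t \<otimes> s = s') \<noteq> odd (\<Sum>i<2*n. of_bool (t = d [^] Suc (Suc i) \<otimes> s) :: nat)))"
    using Suc.IH[of "s' \<otimes> (s \<otimes> t \<otimes> s) \<otimes> s'"] Suc.prems assms t2 by (simp add: d_def)
  also have "\<dots> = odd (\<Sum>i<Suc (Suc (2*n)). of_bool (t = d [^] i \<otimes> s) :: nat)"
    unfolding sum.lessThan_Suc_shift t1 using assms d
    by (simp add: t1 del: nat_pow_Suc)
  finally show ?case by (simp add: d_def)
qed auto

text \<open>As \<open>(s \<otimes> s') [^] n = \<one>\<close>, the reflections met in the second
  half of the relator repeat those of the first half, so each is met an even number of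
  times.\<close>

lemma crosses_relator:
  assumes "w \<in> relators" "t \<in> carrier G"
  shows "\<not> crosses G t w"
proof -
  obtain s s' n where w: "w = concat (replicate n [(s, True), (s', True)])" and s: "s \<in> S" "s' \<in> S"
    using assms(1) by (auto simp: coxeter_relators_def)
  have val: "word_value G (concat (replicate k [(s, True), (s', True)])) = (s \<otimes> s') [^] k" for k
  proof (induction k)
    case (Suc k)
    then show ?case using s nat_pow_Suc2[of "s \<otimes> s'" k] by (simp add: word_value_Cons m_assoc)
  qed simp
  have one: "(s \<otimes> s') [^] n = \<one>"
    using word_value_relator[OF assms(1)] val w by simp
  have split: "(\<Sum>i<a + b. f i) = (\<Sum>i<a. f i) + (\<Sum>i<b. f (a + i))" for a b and f :: "nat \<Rightarrow> nat"
    by (induction b) auto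
  show ?thesis
    unfolding w crosses_power_word[OF s assms(2)] mult_2 split
    using s by (simp add: one flip: nat_pow_mult)
qed

text \<open>A deleted subword has value \<open>\<one>\<close>, so the walls are seen from the same
  point after it, and it crosses each wall an even number of times itself.\<close>

lemma crosses_deletes:
  assumes "deletes S relators v w"
  shows "v \<in> words S \<and> w \<in> words S \<and> (t \<in> carrier G \<longrightarrow> crosses G t v = crosses G t w)"
  using assms
proof cases
  case (cancel u v' s b)
  have "word_value G (u @ [(s, b), (s, \<not> b)]) = word_value G u"
    using cancel by (cases b) (simp_all add: word_value_append word_value_Cons)
  \<comment> \<open>After the first \<open>s\<close> the wall of \<open>x\<close> is seen as that of
    \<open>s x s\<close>, so either both letters of the cancelling pair count or neither
    does.\<close>
  moreover have "s \<otimes> x \<otimes> s = s \<longleftrightarrow> x = s" if "x \<in> carrier G" for x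
    using cancel(5) that by (metis S_closed S_square S_square_cancel S_square_cancel_right l_one m_closed)
  ultimately show ?thesis
    using cancel crosses_append[of "u @ [(s, b), (s, \<not> b)]" v' t] crosses_append[of u v' t]
      crosses_append[of u "[(s, b), (s, \<not> b)]" t] by auto
next
  case (relator u v' r)
  have r: "r \<in> words S" using relator relators_subset by auto
  have "word_value G (u @ r) = word_value G u"
    using relator r word_value_relator by (simp add: word_value_append)
  then show ?thesis
    using relator r crosses_relator[of r] crosses_append[of "u @ r" v' t] crosses_append[of u v' t]
      crosses_append[of u r t] by auto
qed

text \<open>Since the relators present the group, words of equal value are linked by deletions and
  insertions, and each of these keeps the parity.\<close>

lemma crosses_word_value_cong:
  assumes "v \<in> words S" "w \<in> words S" "word_value G v = word_value G w" "t \<in> carrier G"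
  shows "crosses G t v = crosses G t w"
proof -
  have "equivclp (deletes S relators) v w"
    using assms word_value_eq_iff by blast
  then show ?thesis
    by (induction rule: equivclp_induct) (use crosses_deletes assms in blast)+
qed

lemma word_value_surj:
  assumes "x \<in> carrier G"
  obtains w where "w \<in> words S" "word_value G w = x"
proof -
  have "x \<in> generate G S" using assms generate_S by simp
  then have "\<exists>w\<in>words S. word_value G w = x"
  proof (induction rule: generate.induct)
    case one
    then show ?case by (intro bexI[of _ "[]"]) auto
  next
    case (incl h)
    then show ?case by (intro bexI[of _ "[(h, True)]"]) (auto simp: word_value_Cons)
  next
    case (inv h)
    then show ?case by (intro bexI[of _ "[(h, False)]"]) (auto simp: word_value_Cons)
  next
    case (eng h1 h2)
    then obtain u v where "u \<in> words S" "v \<in> words S" "word_value G u = h1" "word_value G v = h2"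
      by auto
    then show ?case by (intro bexI[of _ "u @ v"]) (auto simp: word_value_append)
  qed
  then show ?thesis using that by auto
qed

text \<open>The wall of \<open>t\<close> lies between \<open>\<one>\<close> and \<open>x\<close>. By
  \<open>crosses_word_value_cong\<close> every word for \<open>x\<close> gives the same
  answer.\<close>

definition separates :: "'a \<Rightarrow> 'a \<Rightarrow> bool" where
  "separates t x \<longleftrightarrow> (\<exists>w\<in>words S. word_value G w = x \<and> crosses G t w)"

lemma separates_word_value:
  "w \<in> words S \<Longrightarrow> t \<in> carrier G \<Longrightarrow> separates t (word_value G w) \<longleftrightarrow> crosses G t w"
  unfolding separates_def by (metis crosses_word_value_cong)

lemma not_separates_one: "t \<in> carrier G \<Longrightarrow> \<not> separates t \<one>"
  using separates_word_value[of "[]" t] by simp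

lemma conj_eq_iff:
  assumes "x \<in> carrier G" "s \<in> S" "t \<in> carrier G"
  shows "inv x \<otimes> t \<otimes> x = s \<longleftrightarrow> x \<otimes> s = t \<otimes> x"
proof
  assume "inv x \<otimes> t \<otimes> x = s"
  then have "x \<otimes> (inv x \<otimes> t \<otimes> x) = x \<otimes> s" by simp
  then show "x \<otimes> s = t \<otimes> x" using assms by (simp add: m_assoc)
next
  assume "x \<otimes> s = t \<otimes> x"
  then have "inv x \<otimes> (t \<otimes> x) = inv x \<otimes> (x \<otimes> s)" by simp
  then show "inv x \<otimes> t \<otimes> x = s" using assms by (simp add: m_assoc)
qed

text \<open>The one additional step crosses the wall of \<open>t\<close> exactly when
  \<open>t\<close> swaps the two ends of the edge.\<close>

lemma separates_step:
  assumes "x \<in> carrier G" "s \<in> S" "t \<in> carrier G"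
  shows "separates t (x \<otimes> s) \<longleftrightarrow> separates t x \<noteq> (x \<otimes> s = t \<otimes> x)"
proof -
  obtain w where w: "w \<in> words S" "word_value G w = x"
    using word_value_surj assms(1) by blast
  have "word_value G (w @ [(s, True)]) = x \<otimes> s"
    using w assms by (simp add: word_value_append word_value_Cons)
  then have "separates t (x \<otimes> s) \<longleftrightarrow> crosses G t (w @ [(s, True)])"
    using separates_word_value[of "w @ [(s, True)]" t] w assms by simp
  then show ?thesis
    using crosses_append[of w "[(s, True)]" t] w assms conj_eq_iff[of x s t] separates_word_value[of w t]
    by auto
qed

text \<open>Otherwise the step from \<open>\<one>\<close> to \<open>\<one>\<close> would cross the
  wall of \<open>\<one>\<close> and change sides without moving.\<close>

lemma one_notin_S: "\<one> \<notin> S"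
proof
  assume "\<one> \<in> S"
  from separates_step[OF one_closed this one_closed] not_separates_one[OF one_closed]
  show False by simp
qed

section \<open>Reflections and the two sides of their walls\<close>

definition reflections :: "'a set" where
  "reflections = {x \<otimes> s \<otimes> inv x | x s. x \<in> carrier G \<and> s \<in> S}"

lemma reflections_closed: "t \<in> reflections \<Longrightarrow> t \<in> carrier G"
  by (auto simp: reflections_def)

lemma reflection_square:
  assumes "t \<in> reflections"
  shows "t \<otimes> t = \<one>"
proof -
  obtain x s where t: "t = x \<otimes> s \<otimes> inv x" "x \<in> carrier G" "s \<in> S"
    using assms by (auto simp: reflections_def)
  then show ?thesis by (simp add: m_assoc)
qed

lemma reflection_cancel [simp]: "t \<in> reflections \<Longrightarrow> x \<in> carrier G \<Longrightarrow> t \<otimes> (t \<otimes> x) = x"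
  using m_assoc[of t t x] reflection_square[of t] by (simp add: reflections_closed)

text \<open>A path to \<open>x\<close> is followed by the translate by \<open>x\<close> of a path to
  \<open>y\<close>; translating it back conjugates the wall.\<close>

lemma separates_mult:
  assumes "x \<in> carrier G" "y \<in> carrier G" "t \<in> carrier G"
  shows "separates t (x \<otimes> y) \<longleftrightarrow> separates t x \<noteq> separates (inv x \<otimes> t \<otimes> x) y"
proof -
  obtain u where "u \<in> words S" "word_value G u = x"
    using word_value_surj assms(1) by blast
  moreover obtain v where "v \<in> words S" "word_value G v = y"
    using word_value_surj assms(2) by blast
  ultimately show ?thesis
    using crosses_append[of u v t] word_value_append[of u v] separates_word_value[of "u @ v" t]
      separates_word_value[of u t] separates_word_value[of v "inv x \<otimes> t \<otimes> x"] assms by auto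
qed

text \<open>A path to \<open>t = x s x\<inverse>\<close> spells \<open>x\<close>, \<open>s\<close>
  and \<open>x\<inverse>\<close>. The outer parts cross the wall with equal parity, and the middle
  step crosses it once.\<close>

lemma separates_reflection:
  assumes "t \<in> reflections"
  shows "separates t t"
proof -
  obtain x s where t: "t = x \<otimes> s \<otimes> inv x" "x \<in> carrier G" "s \<in> S"
    using assms by (auto simp: reflections_def)
  have tc: "t \<in> carrier G" using assms by (rule reflections_closed)
  have tx: "x \<otimes> s = t \<otimes> x" using t by (simp add: m_assoc)
  have conj: "inv x \<otimes> t \<otimes> x = s" using t(2,3) tc tx conj_eq_iff[of x s t] by simp
  have "separates t t \<longleftrightarrow> separates t (x \<otimes> s) \<noteq> separates s (inv x)"
  proof -
    have "inv (x \<otimes> s) \<otimes> t \<otimes> (x \<otimes> s) = s \<otimes> (inv x \<otimes> t \<otimes> x) \<otimes> s"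
      using t(2,3) tc by (simp add: inv_mult_group m_assoc)
    also have "\<dots> = s" using t(3) conj by simp
    finally show ?thesis
      using separates_mult[of "x \<otimes> s" "inv x" t] t tc by simp
  qed
  moreover have "separates t (x \<otimes> s) \<longleftrightarrow> \<not> separates t x"
    using separates_step[of x s t] t(2,3) tc tx by simp
  moreover have "separates t x = separates s (inv x)"
    using separates_mult[of x "inv x" t] t(2,3) tc conj not_separates_one[of t] by simp
  ultimately show ?thesis by auto
qed

text \<open>The wall of \<open>t\<close> is fixed under conjugation by \<open>t\<close>, and
  \<open>t\<close> itself lies on its far side.\<close>

lemma separates_reflect:
  assumes "t \<in> reflections" "x \<in> carrier G"
  shows "separates t (t \<otimes> x) \<longleftrightarrow> \<not> separates t x"
proof -
  note reflections_closed [simp]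
  have "inv t \<otimes> t \<otimes> t = t" using assms by simp
  then show ?thesis
    using separates_mult[of t x t] separates_reflection[of t] assms by auto
qed

section \<open>Word length and strong exchange\<close>

definition len :: "'a \<Rightarrow> nat" where
  "len x = (LEAST n. \<exists>w\<in>words S. word_value G w = x \<and> length w = n)"

lemma len_le: "w \<in> words S \<Longrightarrow> len (word_value G w) \<le> length w"
  unfolding len_def by (rule Least_le) auto

lemma reduced_word:
  assumes "x \<in> carrier G"
  obtains w where "w \<in> words S" "word_value G w = x" "length w = len x"
proof -
  have "\<exists>n. \<exists>w\<in>words S. word_value G w = x \<and> length w = n"
    using word_value_surj[OF assms] by blast
  from LeastI_ex[OF this] show ?thesis using that by (auto simp: len_def)
qed

text \<open>An odd number of crossings means at least one. Omitting the letter of a crossing step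
  reflects the rest of the path in the wall, so the end point is multiplied by
  \<open>t\<close>.\<close>

lemma strong_exchange:
  assumes "w \<in> words S" "t \<in> carrier G" "crosses G t w"
  shows "\<exists>w'\<in>words S. length w' < length w \<and> word_value G w' = t \<otimes> word_value G w"
  using assms
proof (induction w arbitrary: t)
  case (Cons a w)
  obtain s b where [simp]: "a = (s, b)" by (cases a)
  from Cons.prems have s: "s \<in> S" and w: "w \<in> words S" by auto
  show ?case
  proof (cases "t = s")
    case True
    then show ?thesis using s w by (intro bexI[of _ w]) (auto simp: word_value_Cons)
  next
    case False
    then have "crosses G (s \<otimes> t \<otimes> s) w" using Cons.prems by auto
    then obtain w' where w': "w' \<in> words S" "length w' < length w"
        "word_value G w' = (s \<otimes> t \<otimes> s) \<otimes> word_value G w"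
      using Cons.IH[of "s \<otimes> t \<otimes> s"] w s Cons.prems by auto
    then show ?thesis
      using s w Cons.prems
      by (intro bexI[of _ "(s, True) # w'"]) (auto simp: word_value_Cons m_assoc)
  qed
qed auto

text \<open>A reduced word for \<open>t x\<close> must cross the wall of \<open>t\<close>, so strong
  exchange shortens it to a word for \<open>x\<close>.\<close>

lemma len_reflect:
  assumes "t \<in> reflections" "x \<in> carrier G" "\<not> separates t x"
  shows "len x < len (t \<otimes> x)"
proof -
  note reflections_closed [simp]
  obtain w where w: "w \<in> words S" "word_value G w = t \<otimes> x" "length w = len (t \<otimes> x)"
    using reduced_word[of "t \<otimes> x"] assms by auto
  have "crosses G t w"
    using separates_word_value[of w t] separates_reflect[of t x] assms w by auto
  then obtain w' where w': "w' \<in> words S" "length w' < length w" "word_value G w' = x"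
    using strong_exchange[of w t] w assms by auto
  then show ?thesis using len_le[of w'] w by simp
qed

section \<open>Bruhat decreasing functions\<close>

text \<open>One lazy step with holding weight \<open>a\<close>. The weights need not sum to 1; the
  normalisation is left to \<open>heat\<close>.\<close>

definition step_op :: "real \<Rightarrow> ('a \<Rightarrow> real) \<Rightarrow> ('a \<Rightarrow> real) \<Rightarrow> 'a \<Rightarrow> real" where
  "step_op a c f x = a * f x + (\<Sum>s\<in>S. c s * f (x \<otimes> s))"

lemma step_op_cong:
  "(\<And>z. z \<in> carrier G \<Longrightarrow> f z = g z) \<Longrightarrow> x \<in> carrier G \<Longrightarrow> step_op a c f x = step_op a c g x"
  by (simp add: step_op_def)

definition pairing :: "('a \<Rightarrow> real) \<Rightarrow> ('a \<Rightarrow> real) \<Rightarrow> real" where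
  "pairing f g = (\<Sum>x\<in>carrier G. f x * g x)"

definition bruhat_decreasing :: "('a \<Rightarrow> real) \<Rightarrow> bool" where
  "bruhat_decreasing f \<longleftrightarrow>
    (\<forall>t\<in>reflections. \<forall>x\<in>carrier G. \<not> separates t x \<longrightarrow> f (t \<otimes> x) \<le> f x)"

definition delta_one :: "'a \<Rightarrow> real" where
  "delta_one x = of_bool (x = \<one>)"

lemma bruhat_decreasingD:
  "bruhat_decreasing f \<Longrightarrow> t \<in> reflections \<Longrightarrow> x \<in> carrier G \<Longrightarrow> \<not> separates t x \<Longrightarrow>
    f (t \<otimes> x) \<le> f x"
  by (auto simp: bruhat_decreasing_def)

lemma edge_reflection:
  assumes "x \<in> carrier G" "s \<in> S"
  obtains t where "t \<in> reflections" "x \<otimes> s = t \<otimes> x"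
proof
  show "x \<otimes> s \<otimes> inv x \<in> reflections" using assms by (auto simp: reflections_def)
  show "x \<otimes> s = x \<otimes> s \<otimes> inv x \<otimes> x" using assms by (simp add: m_assoc)
qed

text \<open>The worst a generator can do is to swap \<open>x\<close> and \<open>t x\<close>, which
  reverses their difference \<open>u\<close>. Laziness of at least \<open>sum c S\<close> outweighs
  all these reversals together.\<close>

lemma bruhat_decreasing_step_op:
  assumes f: "bruhat_decreasing f" and c: "\<And>s. s \<in> S \<Longrightarrow> 0 \<le> c s" "sum c S \<le> a"
  shows "bruhat_decreasing (step_op a c f)"
  unfolding bruhat_decreasing_def
proof (intro ballI impI)
  fix t x assume t: "t \<in> reflections" and x: "x \<in> carrier G" and sep: "\<not> separates t x"
  note tc = reflections_closed[OF t]
  define u where "u = f x - f (t \<otimes> x)"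
  have u: "0 \<le> u" using bruhat_decreasingD[OF f t x sep] by (simp add: u_def)
  have "c s * (f (x \<otimes> s) - f (t \<otimes> x \<otimes> s)) \<ge> c s * (- u)" if s: "s \<in> S" for s
  proof (rule mult_left_mono)
    show "- u \<le> f (x \<otimes> s) - f (t \<otimes> x \<otimes> s)"
    proof (cases "x \<otimes> s = t \<otimes> x")
      case True
      then have "t \<otimes> x \<otimes> s = x" using s x by (metis S_square_cancel_right)
      then show ?thesis using True by (simp add: u_def)
    next
      case False
      then have "\<not> separates t (x \<otimes> s)" using separates_step[OF x s tc] sep by simp
      then have "f (t \<otimes> (x \<otimes> s)) \<le> f (x \<otimes> s)" using bruhat_decreasingD[OF f t] x s by simp
      then show ?thesis using u x s tc by (simp add: m_assoc)
    qed
  qed (use c s in auto)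
  then have "(\<Sum>s\<in>S. c s * (f (x \<otimes> s) - f (t \<otimes> x \<otimes> s))) \<ge> (\<Sum>s\<in>S. c s * (- u))"
    by (rule sum_mono)
  moreover have "(\<Sum>s\<in>S. c s * (- u)) = - (sum c S * u)"
    by (simp add: sum_distrib_right sum_negf)
  moreover have "sum c S * u \<le> a * u" using c u by (intro mult_right_mono)
  ultimately have "0 \<le> a * u + (\<Sum>s\<in>S. c s * (f (x \<otimes> s) - f (t \<otimes> x \<otimes> s)))"
    by linarith
  also have "\<dots> = step_op a c f x - step_op a c f (t \<otimes> x)"
    by (simp add: step_op_def u_def right_diff_distrib sum_subtractf)
  finally show "step_op a c f (t \<otimes> x) \<le> step_op a c f x" by simp
qed

lemma bruhat_decreasing_step_op_power:
  assumes "bruhat_decreasing f" "\<And>s. s \<in> S \<Longrightarrow> 0 \<le> c s" "sum c S \<le> a"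
  shows "bruhat_decreasing ((step_op a c ^^ n) f)"
  by (induction n) (auto intro: bruhat_decreasing_step_op assms)

text \<open>Only \<open>x = t\<close> is reflected to \<open>\<one>\<close>, and that point is on
  the far side.\<close>

lemma bruhat_decreasing_delta_one: "bruhat_decreasing delta_one"
  unfolding bruhat_decreasing_def
proof (intro ballI impI)
  fix t x assume t: "t \<in> reflections" and x: "x \<in> carrier G" and sep: "\<not> separates t x"
  have "x = t" if "t \<otimes> x = \<one>"
    using reflection_cancel[OF t x] reflections_closed[OF t] that by simp
  then show "delta_one (t \<otimes> x) \<le> delta_one x"
    using separates_reflection[OF t] sep by (auto simp: delta_one_def)
qed

text \<open>The ends of an edge are exchanged by a reflection, and both functions are at least as
  large at the end on the identity side.\<close>

lemma edge_differences_same_sign: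
  assumes "bruhat_decreasing f" "bruhat_decreasing g" "x \<in> carrier G" "s \<in> S"
  shows "0 \<le> (f (x \<otimes> s) - f x) * (g (x \<otimes> s) - g x)"
proof -
  obtain t where t: "t \<in> reflections" "x \<otimes> s = t \<otimes> x"
    using edge_reflection assms by metis
  show ?thesis
  proof (cases "separates t x")
    case False
    then show ?thesis
      using assms t bruhat_decreasingD[of f t x] bruhat_decreasingD[of g t x]
      by (simp add: mult_nonpos_nonpos)
  next
    case True
    then have "\<not> separates t (t \<otimes> x)" using t assms separates_reflect by simp
    then have "f (t \<otimes> (t \<otimes> x)) \<le> f (t \<otimes> x)" "g (t \<otimes> (t \<otimes> x)) \<le> g (t \<otimes> x)"
      using bruhat_decreasingD[of f t "t \<otimes> x"] bruhat_decreasingD[of g t "t \<otimes> x"]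
        assms t reflections_closed[of t] by auto
    then show ?thesis using t assms by simp
  qed
qed

lemma sum_translate:

  \<comment> \<open>The pairing: symmetry of steps and monotonicity in their weights\<close>
  "s \<in> S \<Longrightarrow> (\<Sum>x\<in>carrier G. F (x \<otimes> s)) = (\<Sum>x\<in>carrier G. F x)"
  by (rule sum.reindex_bij_witness[of _ "\<lambda>x. x \<otimes> s" "\<lambda>x. x \<otimes> s"]) auto

lemma pairing_translate:
  assumes "s \<in> S"
  shows "pairing f (\<lambda>x. g (x \<otimes> s)) = pairing (\<lambda>x. f (x \<otimes> s)) g"
proof -
  have "pairing f (\<lambda>x. g (x \<otimes> s)) = (\<Sum>x\<in>carrier G. f (x \<otimes> s) * g (x \<otimes> s \<otimes> s))"
    using sum_translate[OF assms, of "\<lambda>x. f x * g (x \<otimes> s)"] by (simp add: pairing_def)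
  then show ?thesis using assms by (simp add: pairing_def)
qed

lemma pairing_step_op_right: "pairing f (step_op a c g) = a * pairing f g + (\<Sum>s\<in>S. c s * pairing f (\<lambda>x. g (x \<otimes> s)))"
  unfolding pairing_def step_op_def sum_distrib_left sum.distrib distrib_left
  by (subst sum.swap) (simp add: mult_ac)

lemma pairing_commute: "pairing f g = pairing g f"
  by (simp add: pairing_def mult.commute)

text \<open>The generators are involutions, so translation by each of them is self-adjoint. This
  lets steps be moved from one function to the other.\<close>

lemma pairing_step_op: "pairing f (step_op a c g) = pairing (step_op a c f) g"
proof -
  have "(\<Sum>s\<in>S. c s * pairing f (\<lambda>x. g (x \<otimes> s))) = (\<Sum>s\<in>S. c s * pairing g (\<lambda>x. f (x \<otimes> s)))"
    by (intro sum.cong refl arg_cong2[of _ _ _ _ "(*)"]) (metis pairing_translate pairing_commute)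
  then show ?thesis
    unfolding pairing_commute[of "step_op a c f"] pairing_step_op_right pairing_commute[of f g] by simp
qed

lemma pairing_step_op_power: "pairing f ((step_op a c ^^ n) g) = pairing ((step_op a c ^^ n) f) g"
proof (induction n arbitrary: f)
  case (Suc n)
  have "pairing f ((step_op a c ^^ Suc n) g) = pairing ((step_op a c ^^ n) (step_op a c f)) g"
    by (simp add: pairing_step_op Suc.IH)
  then show ?case by (simp add: funpow_swap1)
qed simp

text \<open>The products of increments along the \<open>s\<close>-edges are nonnegative, and their
  sum is twice the gap between the two sides.\<close>

lemma pairing_edge_nonpos:
  assumes "bruhat_decreasing f" "bruhat_decreasing g" "s \<in> S"
  shows "pairing f (\<lambda>x. g (x \<otimes> s)) \<le> pairing f g"
proof -
  have "0 \<le> (\<Sum>x\<in>carrier G. (f (x \<otimes> s) - f x) * (g (x \<otimes> s) - g x))"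
    using edge_differences_same_sign assms by (intro sum_nonneg) auto
  also have "\<dots> = (\<Sum>x\<in>carrier G. f (x \<otimes> s) * g (x \<otimes> s)) + pairing f g
      - pairing f (\<lambda>x. g (x \<otimes> s)) - pairing (\<lambda>x. f (x \<otimes> s)) g"
    by (simp add: pairing_def algebra_simps sum.distrib sum_subtractf)
  also have "(\<Sum>x\<in>carrier G. f (x \<otimes> s) * g (x \<otimes> s)) = pairing f g"
    using sum_translate[OF assms(3), of "\<lambda>x. f x * g x"] by (simp add: pairing_def)
  finally show ?thesis using pairing_translate[OF assms(3), of f g] by simp
qed

lemma pairing_step_op_mono:
  assumes "bruhat_decreasing f" "bruhat_decreasing g"
    and "\<And>s. s \<in> S \<Longrightarrow> c s \<le> c' s" "a + sum c S = a' + sum c' S"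
  shows "pairing f (step_op a' c' g) \<le> pairing f (step_op a c g)"
proof -
  have "(\<Sum>s\<in>S. (c' s - c s) * pairing f (\<lambda>x. g (x \<otimes> s))) \<le> (\<Sum>s\<in>S. (c' s - c s) * pairing f g)"
    using assms pairing_edge_nonpos by (intro sum_mono mult_left_mono) auto
  \<comment> \<open>The totals agree, so the weight gained by the generators is the weight
    \<open>a - a'\<close> lost by holding.\<close>
  also have "\<dots> = (a - a') * pairing f g"
    using assms(4) by (simp add: sum_subtractf flip: sum_distrib_right)
  finally show ?thesis
    unfolding pairing_step_op_right by (simp add: algebra_simps sum_subtractf)
qed

text \<open>The steps are exchanged one at a time. A step already taken is absorbed into
  \<open>f\<close> by self-adjointness and keeps it Bruhat decreasing, which is why the induction
  varies \<open>f\<close>.\<close>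

lemma pairing_step_op_power_mono:
  assumes "bruhat_decreasing f" "bruhat_decreasing g"
    and c: "\<And>s. s \<in> S \<Longrightarrow> 0 \<le> c s" "\<And>s. s \<in> S \<Longrightarrow> c s \<le> c' s"
    and a: "a + sum c S = a' + sum c' S" "sum c' S \<le> a'"
  shows "pairing f ((step_op a' c' ^^ n) g) \<le> pairing f ((step_op a c ^^ n) g)"
  using assms(1)
proof (induction n arbitrary: f)
  case (Suc n)
  have cc: "sum c S \<le> sum c' S" using c by (intro sum_mono)
  have c': "0 \<le> c' s" if "s \<in> S" for s using c[OF that] by linarith
  have "pairing f ((step_op a' c' ^^ Suc n) g) = pairing (step_op a' c' f) ((step_op a' c' ^^ n) g)"
    by (simp add: pairing_step_op)
  also have "\<dots> \<le> pairing (step_op a' c' f) ((step_op a c ^^ n) g)"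
    using Suc.prems c' a by (intro Suc.IH bruhat_decreasing_step_op) auto
  also have "\<dots> = pairing f (step_op a' c' ((step_op a c ^^ n) g))"
    by (simp add: pairing_step_op)
  also have "\<dots> \<le> pairing f (step_op a c ((step_op a c ^^ n) g))"
    using Suc.prems c a cc assms(2) by (intro pairing_step_op_mono bruhat_decreasing_step_op_power) auto
  finally show ?case by simp
qed simp

text \<open>Along a reduced word every letter reflects the prefix before it away from
  \<open>\<one>\<close>, so the value can only drop.\<close>

lemma bruhat_decreasing_le_one:
  assumes "bruhat_decreasing f" "x \<in> carrier G"
  shows "f x \<le> f \<one>"
  using assms(2)
proof (induction "len x" arbitrary: x rule: less_induct)
  case less
  obtain w where w: "w \<in> words S" "word_value G w = x" "length w = len x"
    using reduced_word[OF less.prems] by blast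
  show ?case
  proof (cases w rule: rev_cases)
    case (snoc w' a)
    obtain s b where [simp]: "a = (s, b)" by (cases a)
    have s: "s \<in> S" and w': "w' \<in> words S" using w snoc by auto
    define y where "y = word_value G w'"
    have y: "y \<in> carrier G" using w' by (auto simp: y_def)
    have x: "x = y \<otimes> s" using w s w' snoc by (cases b) (auto simp: y_def word_value_append word_value_Cons)
    have len: "len y < len x" using len_le[OF w'] w snoc by (simp add: y_def)
    obtain t where t: "t \<in> reflections" "x = t \<otimes> y" using edge_reflection[OF y s] x by metis
    \<comment> \<open>Otherwise \<open>x\<close> would be on the identity side and hence shorter
      than \<open>y\<close>.\<close>
    have "\<not> separates t y"
      using len_reflect[of t x] separates_reflect[of t y] t y len less.prems by auto
    then have "f x \<le> f y" using bruhat_decreasingD[OF assms(1) t(1) y] t by simp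
    also have "f y \<le> f \<one>" using less.hyps[OF len] y by blast
    finally show ?thesis .
  qed (use w in auto)
qed

text \<open>Among the sets of maximal weight, one of minimal total length is a lower set, since reflecting
  a point down would not lower the weight.\<close>

lemma optimal_lower_set:
  assumes p: "bruhat_decreasing p" and k: "k \<le> card (carrier G)"
  obtains A where "A \<subseteq> carrier G" "card A = k" "bruhat_decreasing (indicator A)"
    "\<forall>B\<subseteq>carrier G. card B = k \<longrightarrow> sum p B \<le> sum p A"
proof -
  define F where "F = {B. B \<subseteq> carrier G \<and> card B = k}"
  have F: "finite F" "F \<noteq> {}"
    using fin obtain_subset_with_card_n[OF k] by (auto simp: F_def)
  define M where "M = Max (sum p ` F)"
  have M: "sum p B \<le> M" if "B \<in> F" for B using F that by (auto simp: M_def)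
  define F' where "F' = {B \<in> F. sum p B = M}"
  have "M \<in> sum p ` F" using F by (auto simp: M_def intro: Max_in)
  then have "finite F'" and F'_ne: "F' \<noteq> {}" using F by (auto simp: F'_def)
  obtain A where A: "A \<in> F'" and minA: "\<And>B. B \<in> F' \<Longrightarrow> sum len A \<le> sum len B"
    using arg_min_if_finite[OF \<open>finite F'\<close> F'_ne, of "sum len"] by (meson not_le)
  then have AF: "A \<in> F" "sum p A = M" by (auto simp: F'_def)
  have finA: "finite A" using AF fin finite_subset by (auto simp: F_def)
  have "x \<in> A" if t: "t \<in> reflections" and x: "x \<in> carrier G" and sep: "\<not> separates t x"
    and tx: "t \<otimes> x \<in> A" for t x
  proof (rule ccontr)
    assume "x \<notin> A"
    define B where "B = insert x (A - {t \<otimes> x})"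
    have "card B = Suc (card (A - {t \<otimes> x}))"
      using \<open>x \<notin> A\<close> finA by (simp add: B_def)
    also have "\<dots> = k"
      using card_Suc_Diff1[OF finA tx] AF by (simp add: F_def)
    finally have "card B = k" .
    then have B: "B \<in> F" using AF x by (auto simp: F_def B_def)
    \<comment> \<open>Applied below to \<open>p\<close>, whose sum does not drop, and to the length,
      whose sum strictly drops.\<close>
    have sumB: "sum h B + h (t \<otimes> x) = sum h A + h x" for h :: "'a \<Rightarrow> real"
      using \<open>x \<notin> A\<close> finA tx by (simp add: B_def sum.remove[of A "t \<otimes> x"])
    have "sum p A \<le> sum p B" using sumB[of p] bruhat_decreasingD[OF p t x sep] by simp
    then have "B \<in> F'" using M[OF B] AF B by (simp add: F'_def)
    then have "sum len A \<le> sum len B" by (rule minA)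
    then have "sum (\<lambda>x. real (len x)) A \<le> sum (\<lambda>x. real (len x)) B"
      by (simp flip: of_nat_sum)
    then show False using len_reflect[OF t x sep] sumB[of "\<lambda>x. real (len x)"] by simp
  qed
  then have "bruhat_decreasing (indicator A)"
    by (auto simp: bruhat_decreasing_def indicator_def)
  moreover have "\<forall>B\<subseteq>carrier G. card B = k \<longrightarrow> sum p B \<le> sum p A"
    using M AF by (auto simp: F_def)
  ultimately show ?thesis using that AF by (auto simp: F_def)
qed

section \<open>The heat semigroup: exponential of the generator with rates \<open>c\<close>, at time
  1\<close>

definition heat :: "real \<Rightarrow> ('a \<Rightarrow> real) \<Rightarrow> ('a \<Rightarrow> real) \<Rightarrow> 'a \<Rightarrow> real" where
  "heat a c f x = exp (- (a + sum c S)) * (\<Sum>n. (step_op a c ^^ n) f x / fact n)"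

lemma step_op_power_bound:
  assumes "\<And>x. x \<in> carrier G \<Longrightarrow> \<bar>f x\<bar> \<le> M" "x \<in> carrier G"
  shows "\<bar>(step_op a c ^^ n) f x\<bar> \<le> (\<bar>a\<bar> + (\<Sum>s\<in>S. \<bar>c s\<bar>)) ^ n * M"
  using assms(2)
proof (induction n arbitrary: x)
  case (Suc n)
  let ?g = "(step_op a c ^^ n) f" and ?B = "(\<bar>a\<bar> + (\<Sum>s\<in>S. \<bar>c s\<bar>)) ^ n * M"
  have "\<bar>step_op a c ?g x\<bar> \<le> \<bar>a * ?g x\<bar> + (\<Sum>s\<in>S. \<bar>c s * ?g (x \<otimes> s)\<bar>)"
    unfolding step_op_def by (intro order_trans[OF abs_triangle_ineq] add_mono order_refl sum_abs)
  also have "\<dots> \<le> \<bar>a\<bar> * ?B + (\<Sum>s\<in>S. \<bar>c s\<bar> * ?B)"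
    unfolding abs_mult using Suc by (intro add_mono sum_mono mult_left_mono) auto
  also have "\<dots> = (\<bar>a\<bar> + (\<Sum>s\<in>S. \<bar>c s\<bar>)) ^ Suc n * M"
    by (simp add: algebra_simps sum_distrib_left sum_distrib_right)
  finally show ?case by simp
qed (use assms in simp)

lemma summable_step_op_power:
  assumes "x \<in> carrier G"
  shows "summable (\<lambda>n. norm ((step_op a c ^^ n) f x / fact n))"
proof -
  define M where "M = (\<Sum>x\<in>carrier G. \<bar>f x\<bar>)"
  have M: "\<bar>f x\<bar> \<le> M" if "x \<in> carrier G" for x
    unfolding M_def using fin that by (intro member_le_sum) auto
  let ?b = "\<bar>a\<bar> + (\<Sum>s\<in>S. \<bar>c s\<bar>)"
  have "summable (\<lambda>n. M * (inverse (fact n) * ?b ^ n))"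
    by (intro summable_mult summable_exp)
  moreover have "norm (norm ((step_op a c ^^ n) f x / fact n)) \<le> M * (inverse (fact n) * ?b ^ n)" for n
    using step_op_power_bound[OF M assms, where a = a and c = c and n = n] by (simp add: field_simps)
  ultimately show ?thesis by (rule summable_comparison_test'[where N = 0])
qed

text \<open>The binomial theorem for the commuting summands \<open>a\<close> times the identity and
  \<open>step_op 0 c\<close>. Division by factorials gives it the form of a Cauchy product.\<close>

lemma step_op_power_binomial:
  assumes "x \<in> carrier G"
  shows "(step_op a c ^^ n) f x / fact n = (\<Sum>k\<le>n. (step_op 0 c ^^ k) f x / fact k * (a ^ (n - k) / fact (n - k)))"
  using assms
proof (induction n arbitrary: x)
  case (Suc n)
  let ?e = "\<lambda>k. (step_op 0 c ^^ k) f x" and ?d = "\<lambda>k. a ^ k / fact k"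
  have e_Suc: "?e (Suc k) = (\<Sum>s\<in>S. c s * (step_op 0 c ^^ k) f (x \<otimes> s))" for k
    by (simp add: step_op_def)
  have "(step_op a c ^^ Suc n) f x / fact n =
      a * ((step_op a c ^^ n) f x / fact n) + (\<Sum>s\<in>S. c s * ((step_op a c ^^ n) f (x \<otimes> s) / fact n))"
    by (simp add: step_op_def add_divide_distrib sum_divide_distrib)
  also have "(step_op a c ^^ n) f x / fact n = (\<Sum>k\<le>n. ?e k / fact k * ?d (n - k))"
    using Suc by simp
  also have "(\<Sum>s\<in>S. c s * ((step_op a c ^^ n) f (x \<otimes> s) / fact n)) =
      (\<Sum>s\<in>S. c s * (\<Sum>k\<le>n. (step_op 0 c ^^ k) f (x \<otimes> s) / fact k * ?d (n - k)))"
    using Suc by (intro sum.cong) auto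
  also have "\<dots> = (\<Sum>k\<le>n. ?e (Suc k) / fact k * ?d (n - k))"
    unfolding e_Suc sum_distrib_left sum_divide_distrib sum_distrib_right
    by (subst sum.swap) (simp add: field_simps)
  finally have step: "(step_op a c ^^ Suc n) f x / fact n =
      a * (\<Sum>k\<le>n. ?e k / fact k * ?d (n - k)) + (\<Sum>k\<le>n. ?e (Suc k) / fact k * ?d (n - k))" .
  \<comment> \<open>Both sums are brought to the range up to \<open>Suc n\<close>, with factors
    \<open>Suc n - k\<close> and \<open>k\<close>. The terms added, \<open>k = Suc n\<close> in the
    first and \<open>k = 0\<close> in the second, vanish, and the two factors add up to
    \<open>Suc n\<close>.\<close>
  have "a * (\<Sum>k\<le>n. ?e k / fact k * ?d (n - k)) =
      (\<Sum>k\<le>n. real (Suc n - k) * (?e k / fact k * ?d (Suc n - k)))"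
    unfolding sum_distrib_left
    by (intro sum.cong refl) (simp add: Suc_diff_le divide_simps)
  also have "\<dots> = (\<Sum>k\<le>Suc n. real (Suc n - k) * (?e k / fact k * ?d (Suc n - k)))"
    by simp
  finally have one: "a * (\<Sum>k\<le>n. ?e k / fact k * ?d (n - k)) =
      (\<Sum>k\<le>Suc n. real (Suc n - k) * (?e k / fact k * ?d (Suc n - k)))" .
  have "(\<Sum>k\<le>n. ?e (Suc k) / fact k * ?d (n - k)) =
      (\<Sum>k\<le>n. real (Suc k) * (?e (Suc k) / fact (Suc k) * ?d (Suc n - Suc k)))"
    by (intro sum.cong refl) (simp add: divide_simps)
  also have "\<dots> = (\<Sum>k\<le>Suc n. real k * (?e k / fact k * ?d (Suc n - k)))"
    by (subst sum.atMost_Suc_shift) simp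
  finally have "(step_op a c ^^ Suc n) f x / fact n =
      (\<Sum>k\<le>Suc n. real (Suc n - k) * (?e k / fact k * ?d (Suc n - k)) +
        real k * (?e k / fact k * ?d (Suc n - k)))"
    unfolding step one sum.distrib by simp
  also have "\<dots> = (\<Sum>k\<le>Suc n. real (Suc n) * (?e k / fact k * ?d (Suc n - k)))"
    by (intro sum.cong refl) (simp only: atMost_iff flip: distrib_right of_nat_add, simp)
  also have "\<dots> = real (Suc n) * (\<Sum>k\<le>Suc n. ?e k / fact k * ?d (Suc n - k))"
    by (simp only: sum_distrib_left)
  finally have "(step_op a c ^^ Suc n) f x / fact n =
      real (Suc n) * (\<Sum>k\<le>Suc n. ?e k / fact k * ?d (Suc n - k))" .
  moreover have "(step_op a c ^^ Suc n) f x / fact (Suc n) = (step_op a c ^^ Suc n) f x / fact n / real (Suc n)"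
    by (simp only: fact_Suc of_nat_mult divide_divide_eq_left mult.commute)
  ultimately show ?case
    using nonzero_mult_div_cancel_left[of "real (Suc n)" "\<Sum>k\<le>Suc n. ?e k / fact k * ?d (Suc n - k)"]
    by (simp del: funpow.simps sum.atMost_Suc fact_Suc of_nat_Suc)
qed simp

text \<open>Laziness \<open>a\<close> only changes the Poisson parameter.\<close>

lemma heat_shift:
  assumes "x \<in> carrier G"
  shows "heat a c f x = heat 0 c f x"
proof -
  let ?e = "\<lambda>k. (step_op 0 c ^^ k) f x / fact k" and ?d = "\<lambda>k. a ^ k / fact k"
  have "summable (\<lambda>k. norm (?d k))"
    using summable_norm_exp[of a] by (simp add: divide_inverse mult.commute)
  moreover have "(\<Sum>k. ?d k) = exp a"
    by (simp add: exp_def divide_inverse mult.commute)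
  ultimately have "(\<lambda>n. \<Sum>k\<le>n. ?e k * ?d (n - k)) sums ((\<Sum>k. ?e k) * exp a)"
    using Cauchy_product_sums[OF summable_step_op_power[OF assms, of 0 c f], of ?d] by simp
  then have "(\<lambda>n. (step_op a c ^^ n) f x / fact n) sums ((\<Sum>k. ?e k) * exp a)"
    by (simp only: step_op_power_binomial[OF assms, where a = a])
  then have "(\<Sum>n. (step_op a c ^^ n) f x / fact n) = (\<Sum>k. ?e k) * exp a"
    by (rule sums_unique[symmetric])
  moreover have "exp (- (a + sum c S)) * exp a = exp (- (0 + sum c S))"
    by (simp flip: exp_add)
  moreover have "x * (y * z) = x * z * y" for x y z :: real by simp
  ultimately show ?thesis unfolding heat_def by (simp only:)
qed

lemma sums_pairing_heat:
  shows "(\<lambda>n. exp (- (a + sum c S)) * (pairing f ((step_op a c ^^ n) g) / fact n)) sums pairing f (heat a c g)"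
proof -
  have "(\<lambda>n. \<Sum>x\<in>carrier G. f x * (exp (- (a + sum c S)) * ((step_op a c ^^ n) g x / fact n))) sums
      (\<Sum>x\<in>carrier G. f x * heat a c g x)"
    unfolding heat_def
    by (intro sums_sum sums_mult summable_sums summable_norm_cancel[OF summable_step_op_power]) auto
  then show ?thesis
    by (simp add: pairing_def sum_distrib_left sum_divide_distrib mult_ac)
qed

lemma pairing_heat: "pairing f (heat a c g) = pairing (heat a c f) g"
  using sums_pairing_heat[of a c f g] sums_pairing_heat[of a c g f]
  by (metis (no_types, lifting) pairing_step_op_power pairing_commute sums_cong sums_unique2)

lemma pairing_indicator: "A \<subseteq> carrier G \<Longrightarrow> pairing (indicator A) f = sum f A"
  unfolding pairing_def using fin by (subst sum.inter_restrict[symmetric] | simp add: Int_absorb1 indicator_def)+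

lemma pairing_delta_one: "pairing delta_one f = f \<one>"
  using fin by (simp add: pairing_def delta_one_def)

lemma bruhat_decreasing_heat:
  assumes "bruhat_decreasing f" "\<And>s. s \<in> S \<Longrightarrow> 0 \<le> c s" "sum c S \<le> a"
  shows "bruhat_decreasing (heat a c f)"
  unfolding bruhat_decreasing_def
proof (intro ballI impI)
  fix t x assume t: "t \<in> reflections" and x: "x \<in> carrier G" and sep: "\<not> separates t x"
  have tx: "t \<otimes> x \<in> carrier G" using reflections_closed[OF t] x by simp
  show "heat a c f (t \<otimes> x) \<le> heat a c f x"
    unfolding heat_def
    using bruhat_decreasingD[OF bruhat_decreasing_step_op_power[OF assms] t x sep] summable_step_op_power x tx
    by (intro mult_left_mono suminf_le divide_right_mono summable_norm_cancel[OF summable_step_op_power]) auto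
qed

text \<open>Equal totals give both series the same exponential prefactor, so they can be compared
  term by term.\<close>

lemma heat_mono:
  assumes "bruhat_decreasing f" "bruhat_decreasing g"
    and "\<And>s. s \<in> S \<Longrightarrow> 0 \<le> c s" "\<And>s. s \<in> S \<Longrightarrow> c s \<le> c' s"
    and "a + sum c S = a' + sum c' S" "sum c' S \<le> a'"
  shows "pairing f (heat a' c' g) \<le> pairing f (heat a c g)"
  using sums_pairing_heat[of a' c' f g] sums_pairing_heat[of a c f g] pairing_step_op_power_mono[OF assms] assms(5)
  by (intro sums_le[OF _ sums_pairing_heat sums_pairing_heat]) (auto intro!: mult_left_mono divide_right_mono)

text \<open>No generator is trivial, so only holding returns to \<open>\<one>\<close> in one
  step.\<close>

lemma step_op_delta_one: "step_op a c delta_one \<one> = a"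
  using one_notin_S by (auto simp: step_op_def delta_one_def intro!: sum.neutral)

text \<open>The difference of the two series has nonnegative terms, and its term
  \<open>n = 1\<close> is a positive multiple of \<open>a - a' > 0\<close>.\<close>

lemma heat_strict_mono:
  assumes c: "\<And>s. s \<in> S \<Longrightarrow> 0 \<le> c s" "\<And>s. s \<in> S \<Longrightarrow> c s \<le> c' s"
    and a: "a + sum c S = a' + sum c' S" "sum c' S \<le> a'" and neq: "\<exists>s\<in>S. c s \<noteq> c' s"
  shows "heat a' c' delta_one \<one> < heat a c delta_one \<one>"
proof -
  define D where "D n = exp (- (a + sum c S)) * (pairing delta_one ((step_op a c ^^ n) delta_one) / fact n) -
    exp (- (a' + sum c' S)) * (pairing delta_one ((step_op a' c' ^^ n) delta_one) / fact n)" for n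
  have D: "D sums (heat a c delta_one \<one> - heat a' c' delta_one \<one>)"
    unfolding D_def using sums_diff[OF sums_pairing_heat[of a c delta_one delta_one] sums_pairing_heat[of a' c' delta_one delta_one]]
    by (simp add: pairing_delta_one)
  have D_eq: "D n = exp (- (a + sum c S)) *
      ((pairing delta_one ((step_op a c ^^ n) delta_one) - pairing delta_one ((step_op a' c' ^^ n) delta_one)) / fact n)" for n
    using a by (simp add: D_def right_diff_distrib diff_divide_distrib)
  have "0 \<le> D n" for n
    unfolding D_eq using pairing_step_op_power_mono[OF bruhat_decreasing_delta_one bruhat_decreasing_delta_one c a] by simp
  moreover have "0 < D 1"
  proof -
    obtain s where s: "s \<in> S" "c s \<noteq> c' s" using neq by blast
    then have "sum c S < sum c' S"
      using finite_S c by (intro sum_strict_mono_ex1) (force simp: order_less_le)+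
    then have "a' < a" using a by linarith
    then show ?thesis unfolding D_eq by (simp add: pairing_delta_one step_op_delta_one)
  qed
  ultimately have "0 < suminf D"
    using D by (intro suminf_pos2[of D 1]) (auto simp: sums_iff)
  then show ?thesis using D by (simp add: sums_iff)
qed

end

section \<open>The transition probabilities as a Poisson mixture\<close>

text \<open>Partial sums of nonnegative times increase, so the jumps up to \<open>T\<close> form an
  initial segment of the naturals.\<close>

lemma card_partial_sums_le:
  fixes f :: "nat \<Rightarrow> real"
  assumes "\<And>k. 0 \<le> f k" "(\<Sum>k<n. f k) \<le> T" "T < (\<Sum>k\<le>n. f k)"
  shows "card {m. (\<Sum>k\<le>m. f k) \<le> T} = n"
proof -
  have "(\<Sum>k\<le>m. f k) \<le> T \<longleftrightarrow> m < n" for m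
  proof
    assume "m < n"
    then have "(\<Sum>k\<le>m. f k) \<le> (\<Sum>k<n. f k)" using assms(1) by (intro sum_mono2) auto
    then show "(\<Sum>k\<le>m. f k) \<le> T" using assms(2) by linarith
  next
    assume m: "(\<Sum>k\<le>m. f k) \<le> T"
    show "m < n"
    proof (rule ccontr)
      assume "\<not> m < n"
      then have "(\<Sum>k\<le>n. f k) \<le> (\<Sum>k\<le>m. f k)" using assms(1) by (intro sum_mono2) auto
      then show False using assms(3) m by linarith
    qed
  qed
  then have "{m. (\<Sum>k\<le>m. f k) \<le> T} = {..<n}" by auto
  then show ?thesis by simp
qed

text \<open>At \<open>T \<ge> 0\<close> the Erlang density of rate 1 is also the Poisson weight
  \<open>exp (- T) * T ^ n / fact n\<close>.\<close>

lemma sums_erlang_density: "0 \<le> T \<Longrightarrow> (\<lambda>n. erlang_density n 1 T) sums 1"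
proof -
  assume T: "0 \<le> T"
  have "(\<lambda>n. exp (- T) * (inverse (fact n) * T ^ n)) sums (exp (- T) * exp T)"
    using exp_converges[of T] by (intro sums_mult) (simp add: divide_inverse scaleR_conv_of_real)
  then show ?thesis
    using T by (simp add: erlang_density_def divide_inverse mult_ac flip: exp_add)
qed

text \<open>Convolution with the exponential density. The exponentials multiply to the constant
  \<open>exp (- T)\<close>, leaving a power of \<open>T - e\<close> on \<open>{0..T}\<close>; for
  negative \<open>T\<close> both sides vanish.\<close>

lemma nn_integral_erlang_step:
  "(\<integral>\<^sup>+e. ennreal (erlang_density n 1 (T - e)) \<partial>density lborel (exponential_density 1)) = ennreal (erlang_density (Suc n) 1 T)"
proof -
  have "(\<integral>\<^sup>+e. ennreal (erlang_density n 1 (T - e)) \<partial>density lborel (exponential_density 1)) =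
      (\<integral>\<^sup>+e. ennreal (exponential_density 1 e) * ennreal (erlang_density n 1 (T - e)) \<partial>lborel)"
    by (subst nn_integral_density) auto
  also have "\<dots> = (\<integral>\<^sup>+e. ennreal (exp (- T) * (T - e) ^ n / fact n) * indicator {0..T} e \<partial>lborel)"
    by (intro nn_integral_cong)
      (auto simp: erlang_density_def indicator_def ennreal_mult'[symmetric] mult_exp_exp)
  also have "\<dots> = ennreal (erlang_density (Suc n) 1 T)"
  proof (cases "0 \<le> T")
    case True
    let ?F = "\<lambda>e. - (exp (- T) * (T - e) ^ Suc n / fact (Suc n))"
    have "(?F has_real_derivative exp (- T) * (T - e) ^ n / fact n) (at e)" for e
    proof -
      have "(?F has_real_derivative - (exp (- T) * (real (Suc n) * (T - e) ^ n * (0 - 1)) / fact (Suc n))) (at e)"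
        by (auto intro!: derivative_eq_intros simp del: fact_Suc power_Suc)
      also have "- (exp (- T) * (real (Suc n) * (T - e) ^ n * (0 - 1)) / fact (Suc n)) =
          exp (- T) * (T - e) ^ n / fact n"
        by (simp add: divide_simps del: of_nat_Suc)
      finally show ?thesis .
    qed
    then have "(\<integral>\<^sup>+e. ennreal (exp (- T) * (T - e) ^ n / fact n) * indicator {0..T} e \<partial>lborel) =
        ennreal (?F T - ?F 0)"
      using True by (intro nn_integral_FTC_Icc) auto
    also have "?F T - ?F 0 = erlang_density (Suc n) 1 T"
      using True by (simp add: erlang_density_def mult_ac)
    finally show ?thesis .
  qed (simp add: erlang_density_def)
  finally show ?thesis .
qed

locale finite_walk = monoid G for G (structure) +
  fixes S :: "'a set" and r :: "'a \<Rightarrow> real"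
  assumes fin: "finite (carrier G)"
    and S_subset: "S \<subseteq> carrier G"
    and r_pos: "\<And>s. s \<in> S \<Longrightarrow> 0 < r s"
begin

abbreviation "\<mu> \<equiv> increment_prob G S r"
abbreviation "E \<equiv> density lborel (exponential_density 1)"
abbreviation "X \<equiv> point_measure (carrier G) \<mu>"
abbreviation "W \<equiv> walk_space G S r"

lemma finite_S: "finite S"
  using S_subset fin finite_subset by blast

lemma sum_increment_prob_mult:
  "(\<Sum>g\<in>carrier G. \<mu> g * f g) = (if S = {} then f \<one> else (\<Sum>s\<in>S. r s * f s) / sum r S)"
proof (cases "S = {}")
  case True
  then show ?thesis
    using fin by (simp add: increment_prob_def if_distrib[of "\<lambda>y. y * _"] cong: if_cong)
next
  case False
  then have "(\<Sum>g\<in>carrier G. \<mu> g * f g) = (\<Sum>g\<in>S. r g / sum r S * f g)"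
    using fin S_subset by (intro sum.mono_neutral_cong_right) (auto simp: increment_prob_def)
  then show ?thesis using False by (simp add: sum_divide_distrib)
qed

lemma sum_increment_prob: "sum \<mu> (carrier G) = 1"
proof -
  have "sum r S \<noteq> 0" if "S \<noteq> {}"
    using sum_pos[of S r] that finite_S r_pos by force
  then show ?thesis using sum_increment_prob_mult[of "\<lambda>_. 1"] by (cases "S = {}") simp_all
qed

lemma r_nonneg: "s \<in> S \<Longrightarrow> 0 \<le> r s"
  using r_pos[of s] by simp

lemma sum_r_nonneg: "0 \<le> sum r S"
  by (simp add: sum_nonneg r_nonneg)

lemma increment_prob_nonneg [simp]: "0 \<le> \<mu> g"
  using r_nonneg sum_r_nonneg by (simp add: increment_prob_def)

lemma prob_space_E: "prob_space E"
  by (rule prob_space_exponential_density) simp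

lemma prob_space_X: "prob_space X"
proof
  have "emeasure X (carrier G) = (\<Sum>g\<in>carrier G. ennreal (\<mu> g))"
    using fin by (simp add: emeasure_point_measure_finite)
  also have "\<dots> = 1" using sum_increment_prob by (simp add: sum_ennreal)
  finally show "emeasure X (space X) = 1" by (simp add: space_point_measure)
qed

sublocale E: prob_space E by (rule prob_space_E)
sublocale X: prob_space X by (rule prob_space_X)
sublocale EX: pair_prob_space E X ..
sublocale seq: sequence_space "E \<Otimes>\<^sub>M X" ..

lemma W_eq: "W = (\<Pi>\<^sub>M n\<in>UNIV. E \<Otimes>\<^sub>M X)"
  by (simp add: walk_space_def)

sublocale W: prob_space W
  unfolding W_eq by (rule seq.P.prob_space_axioms)

lemma space_W: "\<omega> \<in> space W \<longleftrightarrow> (\<forall>k. snd (\<omega> k) \<in> carrier G)"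
  by (auto simp: W_eq space_PiM space_pair_measure space_point_measure PiE_iff mem_Times_iff)

lemma measurable_coord [measurable]: "(\<lambda>\<omega>. \<omega> k) \<in> measurable W (E \<Otimes>\<^sub>M X)"
  unfolding W_eq by measurable

lemma borel_measurable_fst [measurable]: "fst \<in> borel_measurable (E \<Otimes>\<^sub>M X)"
  using measurable_fst[of E X] by (simp cong: measurable_cong_sets)

lemma measurable_time [measurable]: "(\<lambda>\<omega>. fst (\<omega> k)) \<in> borel_measurable W"
  by (rule measurable_compose[OF measurable_coord borel_measurable_fst])

lemma measurable_increment [measurable]:
  "(\<lambda>\<omega>. snd (\<omega> k)) \<in> measurable W (count_space (carrier G))"
proof -
  have "snd \<in> measurable (E \<Otimes>\<^sub>M X) (count_space (carrier G))"
    using measurable_snd[of E X] measurable_cong_sets[OF refl sets_point_measure_count_space]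
    by blast
  then show ?thesis by (rule measurable_compose[OF measurable_coord])
qed

section \<open>The jump chain and the events with a given number of jumps\<close>

definition pos :: "'a \<Rightarrow> nat \<Rightarrow> (nat \<Rightarrow> real \<times> 'a) \<Rightarrow> 'a" where
  "pos x n \<omega> = foldl (\<lambda>y k. y \<otimes> snd (\<omega> k)) x [0..<n]"

lemma pos_0 [simp]: "pos x 0 \<omega> = x"
  by (simp add: pos_def)

lemma pos_Suc: "pos x (Suc n) \<omega> = pos x n \<omega> \<otimes> snd (\<omega> n)"
  by (simp add: pos_def)

lemma pos_closed: "x \<in> carrier G \<Longrightarrow> \<omega> \<in> space W \<Longrightarrow> pos x n \<omega> \<in> carrier G"
  by (induction n) (auto simp: pos_Suc space_W)

lemma pos_case_nat: "pos x (Suc n) (case_nat s \<omega>) = pos (x \<otimes> snd s) n \<omega>"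
  by (induction n) (simp_all add: pos_Suc)

lemma measurable_pos [measurable]:
  assumes "x \<in> carrier G"
  shows "pos x n \<in> measurable W (count_space (carrier G))"
proof (induction n)
  case 0
  then show ?case using assms by (simp add: pos_def[abs_def])
next
  case (Suc n)
  \<comment> \<open>The position so far ranges over a finite set, so it may be replaced by a
    constant \<open>y\<close>.\<close>
  have "(\<lambda>\<omega>. (\<lambda>y \<omega>. y \<otimes> snd (\<omega> n)) (pos x n \<omega>) \<omega>) \<in> measurable W (count_space (carrier G))"
  proof (rule measurable_compose_countable'[OF _ Suc])
    fix y assume "y \<in> carrier G"
    then have "(\<lambda>g. y \<otimes> g) \<in> measurable (count_space (carrier G)) (count_space (carrier G))"
      by auto
    then show "(\<lambda>\<omega>. y \<otimes> snd (\<omega> n)) \<in> measurable W (count_space (carrier G))"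
      by (rule measurable_compose[OF measurable_increment])
  qed (use fin in \<open>simp add: countable_finite\<close>)
  then show ?case by (simp add: pos_Suc[abs_def])
qed

lemma sets_pos: "x \<in> carrier G \<Longrightarrow> {\<omega> \<in> space W. pos x n \<omega> = y} \<in> sets W"
proof (cases "y \<in> carrier G")
  case True
  assume "x \<in> carrier G"
  from measurable_sets[OF measurable_pos[OF this, of n], of "{y}"] True
  show ?thesis by (simp add: vimage_def Int_def conj_commute)
next
  case False
  assume "x \<in> carrier G"
  then have "{\<omega> \<in> space W. pos x n \<omega> = y} = {}" using False pos_closed by auto
  then show ?thesis by (simp only: sets.empty_sets)
qed

text \<open>Exactly \<open>n\<close> jumps up to the rescaled time \<open>T\<close>. Partial sums
  are used instead of \<open>num_jumps\<close>, which takes the default value 0 when infinitely many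
  jumps occur.\<close>

definition at_jump :: "real \<Rightarrow> nat \<Rightarrow> 'a \<Rightarrow> 'a \<Rightarrow> (nat \<Rightarrow> real \<times> 'a) set" where
  "at_jump T n x y = {\<omega> \<in> space W. (\<Sum>k<n. fst (\<omega> k)) \<le> T \<and> T < (\<Sum>k\<le>n. fst (\<omega> k)) \<and> pos x n \<omega> = y}"

lemma sets_at_jump [measurable]:
  assumes "x \<in> carrier G"
  shows "at_jump T n x y \<in> sets W"
proof -
  have "{\<omega> \<in> space W. (\<Sum>k<n. fst (\<omega> k)) \<le> T \<and> T < (\<Sum>k\<le>n. fst (\<omega> k))} \<in> sets W"
    by measurable
  from sets.Int[OF this sets_pos[OF assms, of n y]]
  show ?thesis by (simp add: at_jump_def Int_def conj_ac cong: conj_cong)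
qed

text \<open>The transition operator of the jump chain.\<close>

definition P :: "('a \<Rightarrow> real) \<Rightarrow> 'a \<Rightarrow> real" where
  "P f x = (\<Sum>g\<in>carrier G. \<mu> g * f (x \<otimes> g))"

lemma P_power_nonneg: "(\<And>x. 0 \<le> f x) \<Longrightarrow> 0 \<le> (P ^^ n) f x"
  by (induction n arbitrary: x) (auto simp: P_def intro!: sum_nonneg)

lemma emeasure_E_gt:
  assumes "0 \<le> T"
  shows "emeasure E {T<..} = ennreal (exp (- T))"
proof -
  have D: "distributed E lborel (\<lambda>x. x) (exponential_density 1)"
  proof -
    have "distr E lborel (\<lambda>x. x) = distr E E (\<lambda>x. x)" by (rule distr_cong) simp_all
    then show ?thesis by (simp add: distributed_def distr_id)
  qed
  show ?thesis
    using E.exponential_distributedD_gt[OF D assms] by (simp add: E.emeasure_eq_measure greaterThan_def)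
qed

text \<open>First-step analysis: given the first holding time and increment, the remaining sequence
  has the same law and must make \<open>n\<close> jumps in the remaining time from the new position.
  That time may be negative, so \<open>T\<close> is arbitrary.\<close>

lemma emeasure_at_jump:
  assumes "x \<in> carrier G"
  shows "emeasure W (at_jump T n x y) =
    ennreal (erlang_density n 1 T * (P ^^ n) (\<lambda>z. of_bool (z = y)) x)"
  using assms
proof (induction n arbitrary: T x)
  case 0
  show ?case
  proof (cases "0 \<le> T \<and> x = y")
    case True
    \<comment> \<open>Without a jump only the first holding time is restricted.\<close>
    have "at_jump T 0 x y = (\<lambda>\<omega>. \<omega> 0) -` ({T<..} \<times> carrier G) \<inter> space W"
      using True by (auto simp: at_jump_def space_W mem_Times_iff)
    also have "emeasure W \<dots> = emeasure (distr W (E \<Otimes>\<^sub>M X) (\<lambda>\<omega>. \<omega> 0)) ({T<..} \<times> carrier G)"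
      by (intro emeasure_distr[symmetric] measurable_coord) (auto simp: sets_point_measure)
    also have "distr W (E \<Otimes>\<^sub>M X) (\<lambda>\<omega>. \<omega> 0) = E \<Otimes>\<^sub>M X"
      unfolding W_eq by (intro distr_PiM_component EX.P.prob_space_axioms) auto
    also have "emeasure (E \<Otimes>\<^sub>M X) ({T<..} \<times> carrier G) = emeasure E {T<..} * emeasure X (carrier G)"
      by (intro X.emeasure_pair_measure_Times) (auto simp: sets_point_measure)
    also have "emeasure X (carrier G) = 1"
      using X.emeasure_space_1 by (simp add: space_point_measure)
    finally show ?thesis using True by (simp add: emeasure_E_gt) (simp add: erlang_density_def)
  next
    case False
    then have "at_jump T 0 x y = {}" by (auto simp: at_jump_def)
    then show ?thesis using False by (auto simp: erlang_density_def)
  qed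
next
  case (Suc n)
  let ?d = "\<lambda>z. of_bool (z = y) :: real"
  let ?c = "\<lambda>(s, \<omega>). case_nat s \<omega> :: nat \<Rightarrow> real \<times> 'a"
  let ?A = "at_jump T (Suc n) x y"
  have c: "?c \<in> measurable ((E \<Otimes>\<^sub>M X) \<Otimes>\<^sub>M W) W"
    unfolding W_eq by measurable
  \<comment> \<open>Prepending an independent pair to a sequence with law \<open>W\<close> gives the
    law \<open>W\<close> again.\<close>
  have "emeasure W ?A = emeasure (distr ((E \<Otimes>\<^sub>M X) \<Otimes>\<^sub>M W) W ?c) ?A"
    using seq.PiM_iter by (simp add: W_eq)
  also have "\<dots> = emeasure ((E \<Otimes>\<^sub>M X) \<Otimes>\<^sub>M W) (?c -` ?A \<inter> space ((E \<Otimes>\<^sub>M X) \<Otimes>\<^sub>M W))"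
    using c sets_at_jump[OF Suc.prems] by (intro emeasure_distr)
  also have "\<dots> = (\<integral>\<^sup>+s. emeasure W (Pair s -` (?c -` ?A \<inter> space ((E \<Otimes>\<^sub>M X) \<Otimes>\<^sub>M W))) \<partial>(E \<Otimes>\<^sub>M X))"
    by (intro W.emeasure_pair_measure_alt measurable_sets[OF c sets_at_jump[OF Suc.prems]])
  also have "\<dots> = (\<integral>\<^sup>+s. ennreal (erlang_density n 1 (T - fst s)) * ennreal ((P ^^ n) ?d (x \<otimes> snd s)) \<partial>(E \<Otimes>\<^sub>M X))"
  proof (rule nn_integral_cong)
    fix s assume s: "s \<in> space (E \<Otimes>\<^sub>M X)"
    then have s2: "snd s \<in> carrier G" by (auto simp: space_pair_measure space_point_measure)
    have sum: "(\<Sum>k<Suc n. fst (case_nat s \<omega> k)) = fst s + (\<Sum>k<n. fst (\<omega> k))"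
      "(\<Sum>k\<le>Suc n. fst (case_nat s \<omega> k)) = fst s + (\<Sum>k\<le>n. fst (\<omega> k))" for \<omega>
      by (subst sum.lessThan_Suc_shift sum.atMost_Suc_shift; simp)+
    have sp: "case_nat s \<omega> \<in> space W \<longleftrightarrow> \<omega> \<in> space W" for \<omega>
      unfolding space_W using s2 by (auto split: nat.split)
    have A: "case_nat s \<omega> \<in> ?A \<longleftrightarrow> \<omega> \<in> at_jump (T - fst s) n (x \<otimes> snd s) y" for \<omega>
      unfolding at_jump_def mem_Collect_eq sum sp pos_case_nat le_diff_eq diff_less_eq
      by (simp only: add.commute)
    have "Pair s -` (?c -` ?A \<inter> space ((E \<Otimes>\<^sub>M X) \<Otimes>\<^sub>M W)) = at_jump (T - fst s) n (x \<otimes> snd s) y"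
    proof (rule Set.set_eqI)
      fix \<omega>
      have "\<omega> \<in> Pair s -` (?c -` ?A \<inter> space ((E \<Otimes>\<^sub>M X) \<Otimes>\<^sub>M W)) \<longleftrightarrow>
          case_nat s \<omega> \<in> ?A \<and> \<omega> \<in> space W"
        using s by (simp add: space_pair_measure[of _ W])
      also have "\<dots> \<longleftrightarrow> \<omega> \<in> at_jump (T - fst s) n (x \<otimes> snd s) y"
        unfolding A by (auto simp: at_jump_def)
      finally show "\<omega> \<in> Pair s -` (?c -` ?A \<inter> space ((E \<Otimes>\<^sub>M X) \<Otimes>\<^sub>M W)) \<longleftrightarrow>
          \<omega> \<in> at_jump (T - fst s) n (x \<otimes> snd s) y" .
    qed
    then show "emeasure W (Pair s -` (?c -` ?A \<inter> space ((E \<Otimes>\<^sub>M X) \<Otimes>\<^sub>M W))) =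
        ennreal (erlang_density n 1 (T - fst s)) * ennreal ((P ^^ n) ?d (x \<otimes> snd s))"
      using Suc.IH[of "x \<otimes> snd s" "T - fst s"] Suc.prems s2 P_power_nonneg[of ?d]
      by (simp add: ennreal_mult')
  qed
  \<comment> \<open>Holding time and increment are independent, so the integral can be iterated and
    then factors.\<close>
  also have "\<dots> = (\<integral>\<^sup>+e. \<integral>\<^sup>+g. ennreal (erlang_density n 1 (T - e)) * ennreal ((P ^^ n) ?d (x \<otimes> g)) \<partial>X \<partial>E)"
  proof -
    have "(\<lambda>g. ennreal ((P ^^ n) ?d (x \<otimes> g))) \<in> borel_measurable X" by simp
    from measurable_compose[OF measurable_snd this]
    have [measurable]: "(\<lambda>s. ennreal ((P ^^ n) ?d (x \<otimes> snd s))) \<in> borel_measurable (E \<Otimes>\<^sub>M X)" .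
    show ?thesis
      by (subst X.nn_integral_fst[symmetric]) simp_all
  qed
  also have "\<dots> = (\<integral>\<^sup>+e. ennreal (erlang_density n 1 (T - e)) * ennreal (P ((P ^^ n) ?d) x) \<partial>E)"
  proof (rule nn_integral_cong)
    fix e
    have "(\<integral>\<^sup>+g. ennreal ((P ^^ n) ?d (x \<otimes> g)) \<partial>X) = ennreal (P ((P ^^ n) ?d) x)"
      using fin P_power_nonneg[of ?d]
      by (simp add: nn_integral_point_measure_finite P_def sum_ennreal ennreal_mult'[symmetric])
    then show "(\<integral>\<^sup>+g. ennreal (erlang_density n 1 (T - e)) * ennreal ((P ^^ n) ?d (x \<otimes> g)) \<partial>X) =
        ennreal (erlang_density n 1 (T - e)) * ennreal (P ((P ^^ n) ?d) x)"
      by (simp add: nn_integral_cmult)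
  qed
  also have "\<dots> = ennreal (erlang_density (Suc n) 1 T) * ennreal (P ((P ^^ n) ?d) x)"
    by (subst nn_integral_multc) (auto simp: nn_integral_erlang_step)
  also have "\<dots> = ennreal (erlang_density (Suc n) 1 T * (P ^^ Suc n) ?d x)"
    using P_power_nonneg[of ?d "Suc n" x] by (simp add: ennreal_mult')
  finally show ?case .
qed

lemma measure_at_jump:
  assumes "x \<in> carrier G"
  shows "measure W (at_jump T n x y) = erlang_density n 1 T * (P ^^ n) (\<lambda>z. of_bool (z = y)) x"
  using emeasure_at_jump[OF assms] P_power_nonneg[of "\<lambda>z. of_bool (z = y)"]
  by (intro measure_eq_emeasure_eq_ennreal) auto

lemma AE_time_nonneg: "AE \<omega> in W. \<forall>k. 0 \<le> fst (\<omega> k)"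
proof -
  have "AE e in E. 0 \<le> e"
    by (subst AE_density) (auto simp: erlang_density_def)
  moreover have "{s \<in> space (E \<Otimes>\<^sub>M X). 0 \<le> fst s} \<in> sets (E \<Otimes>\<^sub>M X)"
    by (rule borel_measurable_le[OF borel_measurable_const borel_measurable_fst])
  ultimately have "AE s in E \<Otimes>\<^sub>M X. 0 \<le> fst s"
    by (intro EX.AE_pair_measure) simp_all
  then have "AE \<omega> in W. 0 \<le> fst (\<omega> k)" for k
    unfolding W_eq by (intro AE_PiM_component[where P = "\<lambda>s. 0 \<le> fst s"] EX.P.prob_space_axioms) auto
  then show ?thesis by (simp add: AE_all_countable)
qed

text \<open>The jump chain conserves mass; this gives the total mass 1 of the Poisson
  mixture.\<close>

lemma sum_P_power_indicators:
  assumes "x \<in> carrier G"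
  shows "(\<Sum>y\<in>carrier G. (P ^^ n) (\<lambda>z. of_bool (z = y)) x) = 1"
  using assms
proof (induction n arbitrary: x)
  case (Suc n)
  have "(\<Sum>y\<in>carrier G. (P ^^ Suc n) (\<lambda>z. of_bool (z = y)) x) =
      (\<Sum>g\<in>carrier G. \<mu> g * (\<Sum>y\<in>carrier G. (P ^^ n) (\<lambda>z. of_bool (z = y)) (x \<otimes> g)))"
    unfolding sum_distrib_left by (subst sum.swap) (simp add: P_def)
  also have "\<dots> = 1" using Suc sum_increment_prob by simp
  finally show ?case .
qed (use fin in simp)

lemma P_power_le_1:
  assumes "x \<in> carrier G" "y \<in> carrier G"
  shows "(P ^^ n) (\<lambda>z. of_bool (z = y)) x \<le> 1"
proof -
  have "(P ^^ n) (\<lambda>z. of_bool (z = y)) x \<le> (\<Sum>y\<in>carrier G. (P ^^ n) (\<lambda>z. of_bool (z = y)) x)"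
    using fin assms by (intro member_le_sum) (auto intro: P_power_nonneg)
  then show ?thesis using sum_P_power_indicators[OF assms(1)] by simp
qed

lemma summable_transition:
  assumes "0 \<le> T" "x \<in> carrier G" "y \<in> carrier G"
  shows "summable (\<lambda>n. erlang_density n 1 T * (P ^^ n) (\<lambda>z. of_bool (z = y)) x)"
proof (rule summable_comparison_test'[where N = 0])
  show "summable (\<lambda>n. erlang_density n 1 T)"
    using sums_erlang_density[OF assms(1)] by (rule sums_summable)
  show "norm (erlang_density n 1 T * (P ^^ n) (\<lambda>z. of_bool (z = y)) x) \<le> erlang_density n 1 T" for n
    using P_power_le_1[OF assms(2,3), of n] P_power_nonneg[of "\<lambda>z. of_bool (z = y)" n x]
    by (simp add: mult_left_le)
qed

lemma sum_transition_series:
  assumes "0 \<le> T" "x \<in> carrier G"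
  shows "(\<Sum>y\<in>carrier G. \<Sum>n. erlang_density n 1 T * (P ^^ n) (\<lambda>z. of_bool (z = y)) x) = 1"
proof -
  have "(\<lambda>n. \<Sum>y\<in>carrier G. erlang_density n 1 T * (P ^^ n) (\<lambda>z. of_bool (z = y)) x) sums
      (\<Sum>y\<in>carrier G. \<Sum>n. erlang_density n 1 T * (P ^^ n) (\<lambda>z. of_bool (z = y)) x)"
    using summable_transition[OF assms] by (intro sums_sum summable_sums) auto
  moreover have "(\<Sum>y\<in>carrier G. erlang_density n 1 T * (P ^^ n) (\<lambda>z. of_bool (z = y)) x) = erlang_density n 1 T" for n
    by (simp add: sum_P_power_indicators[OF assms(2)] flip: sum_distrib_left)
  ultimately show ?thesis
    using sums_erlang_density[OF assms(1)] by (simp add: sums_iff)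
qed

text \<open>The events \<open>at_jump\<close> only give a lower bound, as they leave out the
  sample points with infinitely many jumps; it is sharp because both sides sum up to 1.\<close>

theorem transition_prob_eq:
  assumes t: "0 \<le> t" and x: "x \<in> carrier G" and y: "y \<in> carrier G"
  shows "transition_prob G S r t x y =
    (\<Sum>n. erlang_density n 1 (sum r S * t) * (P ^^ n) (\<lambda>z. of_bool (z = y)) x)"
proof -
  \<comment> \<open>In this unit of time the holding times have rate 1.\<close>
  define T where "T = sum r S * t"
  have T: "0 \<le> T" using t sum_r_nonneg by (simp add: T_def)
  define N where "N \<omega> = num_jumps S r t \<omega>" for \<omega> :: "nat \<Rightarrow> real \<times> 'a"
  have walk: "walk G S r x t \<omega> = pos x (N \<omega>) \<omega>" for \<omega>
    by (simp add: walk_def pos_def N_def)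
  have N_meas: "N \<in> measurable W (count_space UNIV)"
    unfolding N_def num_jumps_def by (rule measurable_card) simp
  define B where "B y n = {\<omega> \<in> space W. N \<omega> = n \<and> pos x n \<omega> = y}" for y n
  have B: "B y n \<in> sets W" for y n
  proof -
    have "N -` {n} \<inter> space W \<in> sets W" using N_meas by (rule measurable_sets) simp
    from sets.Int[OF this sets_pos[OF x, of n y]]
    show ?thesis by (simp add: B_def vimage_def Int_def conj_ac cong: conj_cong)
  qed
  define C where "C y = {\<omega> \<in> space W. walk G S r x t \<omega> = y}" for y
  have C_eq: "C y = (\<Union>n. B y n)" for y by (auto simp: C_def B_def walk)
  have C: "C y \<in> sets W" for y unfolding C_eq using B by blast
  define q where "q y = (\<Sum>n. erlang_density n 1 T * (P ^^ n) (\<lambda>z. of_bool (z = y)) x)" for y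
  have q_le: "q y \<le> measure W (C y)" if "y \<in> carrier G" for y
  proof -
    have "(\<lambda>n. measure W (B y n)) sums measure W (C y)"
      unfolding C_eq using B by (intro W.finite_measure_UNION) (auto simp: disjoint_family_on_def B_def)
    moreover have "measure W (at_jump T n x y) \<le> measure W (B y n)" for n
    proof (rule W.finite_measure_mono_AE[OF _ B])
      show "AE \<omega> in W. \<omega> \<in> at_jump T n x y \<longrightarrow> \<omega> \<in> B y n"
        using AE_time_nonneg
      proof eventually_elim
        case (elim \<omega>)
        then show ?case
          using card_partial_sums_le[of "\<lambda>k. fst (\<omega> k)" n T]
          by (auto simp: at_jump_def B_def N_def num_jumps_def T_def)
      qed
    qed
    ultimately show ?thesis
      using summable_transition[OF T x that] unfolding q_def measure_at_jump[OF x, symmetric]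
      by (intro sums_le[OF _ summable_sums]) auto
  qed
  have "sum q (carrier G) = 1"
    unfolding q_def using sum_transition_series[OF T x] .
  moreover have "(\<Sum>y\<in>carrier G. measure W (C y)) \<le> 1"
  proof -
    have "(\<Sum>y\<in>carrier G. measure W (C y)) = measure W (\<Union>y\<in>carrier G. C y)"
      using fin C by (intro W.finite_measure_finite_Union[symmetric]) (auto simp: disjoint_family_on_def C_def)
    then show ?thesis by simp
  qed
  \<comment> \<open>Every difference is nonnegative by \<open>q_le\<close>, so a sum that is at most
    0 forces all of them to vanish.\<close>
  ultimately have "(\<Sum>y\<in>carrier G. measure W (C y) - q y) \<le> 0"
    by (simp add: sum_subtractf)
  then have "measure W (C y) - q y = 0"
    using sum_nonneg_eq_0_iff[OF fin, of "\<lambda>y. measure W (C y) - q y"] q_le y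
    by (metis (no_types, lifting) diff_ge_0_iff_ge order_antisym sum_nonneg)
  then show ?thesis by (simp add: transition_prob_def C_def q_def T_def)
qed

corollary sum_transition_prob:
  assumes "0 \<le> t" "x \<in> carrier G"
  shows "(\<Sum>y\<in>carrier G. transition_prob G S r t x y) = 1"
  using sum_transition_series[of "sum r S * t" x] assms sum_r_nonneg
  by (simp add: transition_prob_eq cong: sum.cong)

end

section \<open>Decreasing rearrangements\<close>

text \<open>Enumerating the index set by decreasing value turns partial sums of the rearrangement
  into sums over subsets.\<close>

lemma decreasing_rearrangement_enumeration:
  assumes "finite A"
  obtains xs where "distinct xs" "set xs = A" "decreasing_rearrangement A f = map f xs"
    "sorted (rev (map f xs))"
proof -
  obtain ys where ys: "distinct ys" "set ys = A"
    using finite_distinct_list[OF assms] by blast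
  define xs where "xs = sort_key (\<lambda>x. - f x) ys"
  have xs: "distinct xs" "set xs = A" using ys by (auto simp: xs_def)
  have "sorted (map (\<lambda>x. - f x) xs)" by (simp add: xs_def)
  then have sorted: "sorted (rev (map f xs))"
    unfolding sorted_rev_iff_nth_mono by (simp add: sorted_iff_nth_mono)
  have "image_mset f (mset_set A) = mset (rev (map f xs))"
    using xs by (simp flip: xs(2) add: mset_set_set)
  then have "decreasing_rearrangement A f = map f xs"
    using sorted by (simp only: decreasing_rearrangement_def sorted_list_of_multiset_mset)
      (simp only: sorted_sort_id rev_rev_ident)
  then show ?thesis using that xs sorted by blast
qed

lemma sum_map_take:
  assumes "distinct xs" "k \<le> length xs"
  shows "(\<Sum>j<k. map f xs ! j) = sum f (set (take k xs))"
proof -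
  have "sum f (set (take k xs)) = sum_list (map f (take k xs))"
    using assms by (simp add: sum.distinct_set_conv_list)
  also have "\<dots> = (\<Sum>j<k. map f xs ! j)"
    using assms by (simp add: sum_list_sum_nth atLeast0LessThan)
  finally show ?thesis by simp
qed

lemma sum_decreasing_rearrangement_attained:
  assumes "finite A" "k \<le> card A"
  obtains B where "B \<subseteq> A" "card B = k" "sum f B = (\<Sum>j<k. decreasing_rearrangement A f ! j)"
proof -
  obtain xs where xs: "distinct xs" "set xs = A" "decreasing_rearrangement A f = map f xs"
    using decreasing_rearrangement_enumeration[OF assms(1)] by metis
  have k: "k \<le> length xs" using assms xs distinct_card by metis
  show ?thesis
  proof
    show "set (take k xs) \<subseteq> A" using xs set_take_subset by metis
    show "card (set (take k xs)) = k" using xs k by (simp add: distinct_card)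
    show "sum f (set (take k xs)) = (\<Sum>j<k. decreasing_rearrangement A f ! j)"
      using sum_map_take[OF xs(1) k, of f] xs(3) by simp
  qed
qed

text \<open>With \<open>K\<close> the indices of the \<open>card B\<close> largest values,
  \<open>B - K\<close> and \<open>K - B\<close> have equal size, and a threshold separates the
  values on them.\<close>

lemma sum_le_sum_decreasing_rearrangement:
  assumes "finite A" "B \<subseteq> A"
  shows "sum f B \<le> (\<Sum>j<card B. decreasing_rearrangement A f ! j)"
proof (cases "B = {}")
  case False
  obtain xs where xs: "distinct xs" "set xs = A" "decreasing_rearrangement A f = map f xs"
    "sorted (rev (map f xs))"
    using decreasing_rearrangement_enumeration[OF assms(1)] by metis
  define k where "k = card B"
  have finB: "finite B" using assms finite_subset by blast
  have k0: "0 < k" using False finB by (simp add: k_def card_gt_0_iff)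
  have k: "k \<le> length xs" using card_mono[OF assms] xs distinct_card by (metis k_def)
  define K where "K = set (take k xs)"
  have K: "finite K" "card K = k" using xs k by (auto simp: K_def distinct_card)
  \<comment> \<open>The smallest of the \<open>k\<close> largest values.\<close>
  define \<theta> where "\<theta> = f (xs ! (k - 1))"
  have mono: "f (xs ! j) \<le> f (xs ! i)" if "i \<le> j" "j < length xs" for i j
    using xs(4) that by (simp add: sorted_rev_iff_nth_mono)
  have ge: "\<theta> \<le> f x" if "x \<in> K" for x
  proof -
    obtain i where "i < k" "x = xs ! i"
      using \<open>x \<in> K\<close> k by (auto simp: K_def in_set_conv_nth)
    then show ?thesis using mono[of i "k - 1"] k k0 by (simp add: \<theta>_def)
  qed
  have le: "f x \<le> \<theta>" if "x \<in> B - K" for x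
  proof -
    have "x \<in> set xs" using that assms xs by auto
    then obtain i where i: "i < length xs" "x = xs ! i" by (auto simp: in_set_conv_nth)
    have "k \<le> i"
    proof (rule ccontr)
      assume "\<not> k \<le> i"
      then have "x \<in> K" using i k by (auto simp: K_def in_set_conv_nth intro!: exI[of _ i])
      then show False using that by simp
    qed
    then show ?thesis using mono[of "k - 1" i] i by (simp add: \<theta>_def)
  qed
  have card_eq: "card (B - K) = card (K - B)"
  proof -
    have "card (B \<inter> K) + card (B - K) = k" "card (B \<inter> K) + card (K - B) = k"
      using card_Int_Diff[OF finB, of K] card_Int_Diff[OF K(1), of B] K
      by (simp_all add: k_def Int_commute)
    then show ?thesis by linarith
  qed
  have "sum f B = sum f (B \<inter> K) + sum f (B - K)"
    using finB by (subst sum.Int_Diff[of _ _ K]) auto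
  also have "\<dots> \<le> sum f (B \<inter> K) + (\<Sum>x\<in>B - K. \<theta>)"
    using le by (intro add_left_mono sum_mono) auto
  also have "(\<Sum>x\<in>B - K. \<theta>) = (\<Sum>x\<in>K - B. \<theta>)" by (simp add: card_eq)
  also have "sum f (B \<inter> K) + (\<Sum>x\<in>K - B. \<theta>) \<le> sum f (B \<inter> K) + sum f (K - B)"
    using ge by (intro add_left_mono sum_mono) auto
  also have "\<dots> = sum f K"
    using K by (subst sum.Int_Diff[of K _ B]) (auto simp: Int_commute)
  also have "\<dots> = (\<Sum>j<card B. decreasing_rearrangement A f ! j)"
    using sum_map_take[OF xs(1) k, of f] xs(3) by (simp add: K_def k_def)
  finally show ?thesis .
qed simp

section \<open>Monotonicity in the rates\<close>

context finite_coxeter_system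
begin

text \<open>The factor \<open>T ^ n\<close> of the Poisson weight turns \<open>n\<close> steps of
  the jump chain into \<open>n\<close> unnormalised steps with weights \<open>t * r s\<close>. The
  laziness \<open>a\<close> is then free by \<open>heat_shift\<close>.\<close>

lemma transition_prob_eq_heat:
  assumes r: "\<forall>s\<in>S. 0 < r s" and t: "0 \<le> t" and y: "y \<in> carrier G"
  shows "transition_prob G S r t \<one> y = heat a (\<lambda>s. t * r s) delta_one y"
proof -
  interpret walk: finite_walk G S r
    using fin S_subset r by unfold_locales auto
  define T where "T = sum r S * t"
  let ?c = "\<lambda>s. t * r s" and ?d = "\<lambda>z. of_bool (z = y) :: real"
  have T: "0 \<le> T" using t walk.sum_r_nonneg by (simp add: T_def)
  have T_eq: "sum ?c S = T" by (simp add: T_def mult.commute flip: sum_distrib_left)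
  have step: "T * walk.P f x = step_op 0 ?c f x" for f x
  proof (cases "S = {}")
    case False
    then have "sum r S \<noteq> 0" using sum_pos[of S r] finite_S r by force
    then have "T * walk.P f x = t * (\<Sum>s\<in>S. r s * f (x \<otimes> s))"
      using False walk.sum_increment_prob_mult[of "\<lambda>g. f (x \<otimes> g)"]
      by (simp add: walk.P_def T_def)
    then show ?thesis by (simp add: step_op_def sum_distrib_left mult_ac)
  next
    case True
    \<comment> \<open>Here \<open>T = 0\<close>, as the sum of the rates is empty.\<close>
    show ?thesis unfolding T_def step_op_def using True by simp
  qed
  have power: "T ^ n * (walk.P ^^ n) f x = (step_op 0 ?c ^^ n) f x" if "x \<in> carrier G" for n f x
    using that
  proof (induction n arbitrary: x)
    case (Suc n)
    have "T ^ Suc n * (walk.P ^^ Suc n) f x = T * walk.P (\<lambda>z. T ^ n * (walk.P ^^ n) f z) x"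
      by (simp add: walk.P_def sum_distrib_left mult_ac)
    also have "\<dots> = step_op 0 ?c (\<lambda>z. T ^ n * (walk.P ^^ n) f z) x"
      by (rule step)
    also have "\<dots> = step_op 0 ?c ((step_op 0 ?c ^^ n) f) x"
      by (rule step_op_cong[OF Suc.IH Suc.prems])
    finally show ?case by simp
  qed simp
  have "transition_prob G S r t \<one> y = (\<Sum>n. erlang_density n 1 T * (walk.P ^^ n) ?d \<one>)"
    using walk.transition_prob_eq[OF t one_closed y] by (simp add: T_def)
  also have "(\<lambda>n. erlang_density n 1 T * (walk.P ^^ n) ?d \<one>) =
      (\<lambda>n. exp (- T) * ((step_op 0 ?c ^^ n) ?d \<one> / fact n))"
    using T by (auto simp: erlang_density_def mult_ac simp flip: power)
  also have "(\<Sum>n. exp (- T) * ((step_op 0 ?c ^^ n) ?d \<one> / fact n)) = heat 0 ?c ?d \<one>"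
    unfolding heat_def T_eq
    by (subst suminf_mult) (auto intro: summable_norm_cancel[OF summable_step_op_power])
  \<comment> \<open>By symmetry the indicator of the end point evaluated at \<open>\<one>\<close>
    becomes \<open>delta_one\<close> evaluated at the end point.\<close>
  also have "\<dots> = pairing delta_one (heat 0 ?c ?d)" by (simp add: pairing_delta_one)
  also have "\<dots> = pairing (heat 0 ?c delta_one) ?d" by (rule pairing_heat)
  also have "\<dots> = heat 0 ?c delta_one y" using y fin by (simp add: pairing_def of_bool_def if_distrib cong: if_cong)
  finally show ?thesis by (simp only: heat_shift[OF y, of a])
qed

lemma rates_majorization:
  assumes r: "\<forall>s\<in>S. 0 < r s" "\<forall>s\<in>S. 0 < r' s" "\<forall>s\<in>S. r s \<le> r' s" and t: "0 < t"
  shows "majorizes (carrier G) (transition_prob G S r t \<one>) (transition_prob G S r' t \<one>)"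
    and "\<exists>s\<in>S. r s \<noteq> r' s \<Longrightarrow>
      decreasing_rearrangement (carrier G) (transition_prob G S r t \<one>) \<noteq>
      decreasing_rearrangement (carrier G) (transition_prob G S r' t \<one>)"
proof -
  let ?c = "\<lambda>s. t * r s" and ?c' = "\<lambda>s. t * r' s"
  let ?p = "transition_prob G S r t \<one>" and ?p' = "transition_prob G S r' t \<one>"
  let ?L = "decreasing_rearrangement (carrier G) ?p" and ?L' = "decreasing_rearrangement (carrier G) ?p'"
  \<comment> \<open>\<open>a'\<close> is the least laziness that
    \<open>bruhat_decreasing_step_op\<close> admits for \<open>?c'\<close>; \<open>a\<close> is
    chosen so that both totals are \<open>2 * sum ?c' S\<close>.\<close>
  define a' where "a' = sum ?c' S"
  define a where "a = 2 * sum ?c' S - sum ?c S"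
  have c: "0 \<le> ?c s" "?c s \<le> ?c' s" "0 \<le> ?c' s" if "s \<in> S" for s
    using r t that by (auto simp: less_imp_le)
  have a: "a + sum ?c S = a' + sum ?c' S" "sum ?c' S \<le> a'" by (auto simp: a_def a'_def)
  have p: "?p y = heat a ?c delta_one y" and p': "?p' y = heat a' ?c' delta_one y" if "y \<in> carrier G" for y
    using transition_prob_eq_heat that r t by auto
  have dec: "bruhat_decreasing (heat a' ?c' delta_one)"
    by (rule bruhat_decreasing_heat[OF bruhat_decreasing_delta_one c(3) a(2)])
  show "majorizes (carrier G) ?p ?p'"
    unfolding majorizes_def
  proof (intro conjI ballI)
    fix k assume "k \<in> {1..card (carrier G)}"
    then have k: "k \<le> card (carrier G)" by simp
    obtain B where B: "B \<subseteq> carrier G" "card B = k" "sum ?p' B = (\<Sum>j<k. ?L' ! j)"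
      using sum_decreasing_rearrangement_attained[OF fin k] by blast
    \<comment> \<open>For the rates \<open>r'\<close> the \<open>k\<close> largest values can be
      collected on a lower set, and on such a set the rates \<open>r\<close> leave at least as much
      mass.\<close>
    obtain A where A: "A \<subseteq> carrier G" "card A = k" "bruhat_decreasing (indicator A)"
      and opt: "\<forall>B\<subseteq>carrier G. card B = k \<longrightarrow>
        sum (heat a' ?c' delta_one) B \<le> sum (heat a' ?c' delta_one) A"
      by (rule optimal_lower_set[OF dec k])
    have "(\<Sum>j<k. ?L' ! j) = sum (heat a' ?c' delta_one) B"
      unfolding B(3)[symmetric] using B(1) p' by (intro sum.cong) auto
    also have "\<dots> \<le> pairing (indicator A) (heat a' ?c' delta_one)" using opt B(1,2) A(1) by (simp add: pairing_indicator)
    also have "\<dots> \<le> pairing (indicator A) (heat a ?c delta_one)"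
      by (rule heat_mono[OF A(3) bruhat_decreasing_delta_one c(1,2) a])
    also have "\<dots> = sum ?p A"
      unfolding pairing_indicator[OF A(1)] using A(1) p by (intro sum.cong) auto
    also have "\<dots> \<le> (\<Sum>j<k. ?L ! j)"
      using sum_le_sum_decreasing_rearrangement[OF fin A(1), of ?p] A(2) by simp
    finally show "(\<Sum>j<k. ?L' ! j) \<le> (\<Sum>j<k. ?L ! j)" .
  next
    have total: "(\<Sum>j<card (carrier G). decreasing_rearrangement (carrier G) f ! j) = sum f (carrier G)"
      for f :: "'a \<Rightarrow> real"
    proof -
      obtain B where "B \<subseteq> carrier G" "card B = card (carrier G)"
        "sum f B = (\<Sum>j<card (carrier G). decreasing_rearrangement (carrier G) f ! j)"
        using sum_decreasing_rearrangement_attained[OF fin order_refl] by blast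
      moreover from this have "B = carrier G" using card_subset_eq[OF fin] by blast
      ultimately show ?thesis by simp
    qed
    interpret walk: finite_walk G S r
      using fin S_subset r by unfold_locales auto
    interpret walk': finite_walk G S r'
      using fin S_subset r by unfold_locales auto
    show "(\<Sum>j<card (carrier G). ?L ! j) = (\<Sum>j<card (carrier G). ?L' ! j)"
      unfolding total using walk.sum_transition_prob walk'.sum_transition_prob t by simp
  qed
  show "?L \<noteq> ?L'" if neq: "\<exists>s\<in>S. r s \<noteq> r' s"
  proof
    assume L: "?L = ?L'"
    have one: "1 \<le> card (carrier G)" using fin one_closed card_gt_0_iff[of "carrier G"] by force
    \<comment> \<open>The first entry of a rearrangement is the maximum. For \<open>r'\<close> it is
      attained at \<open>\<one>\<close>, where \<open>r\<close> gives strictly more.\<close>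
    obtain B where B: "B \<subseteq> carrier G" "card B = 1" "sum ?p' B = (\<Sum>j<1. ?L' ! j)"
      using sum_decreasing_rearrangement_attained[OF fin one] by blast
    then obtain x where x: "B = {x}" "x \<in> carrier G" by (auto simp: card_1_singleton_iff)
    have "(\<Sum>j<1. ?L' ! j) = heat a' ?c' delta_one x" using B x p' by simp
    also have "\<dots> \<le> heat a' ?c' delta_one \<one>" using bruhat_decreasing_le_one[OF dec x(2)] .
    also have "\<dots> < heat a ?c delta_one \<one>"
      by (rule heat_strict_mono[OF c(1,2) a]) (use neq t in auto)
    also have "\<dots> = sum ?p {\<one>}" using p by simp
    also have "\<dots> \<le> (\<Sum>j<1. ?L ! j)"
      using sum_le_sum_decreasing_rearrangement[OF fin, of "{\<one>}" ?p] by simp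
    finally show False using L by simp
  qed
qed

end

theorem theorem1p2:
  fixes G :: "('a, 'b) monoid_scheme" and S :: "'a set"
    and r r' :: "'a \<Rightarrow> real" and t :: real
  assumes "coxeter_system G S" and "finite (carrier G)"
    and "\<forall>s\<in>S. 0 < r s" and "\<forall>s\<in>S. 0 < r' s"
    and "\<forall>s\<in>S. r s \<le> r' s"
    and "0 < t"
  shows "majorizes (carrier G) (transition_prob G S r t \<one>\<^bsub>G\<^esub>) (transition_prob G S r' t \<one>\<^bsub>G\<^esub>) \<and>
    ((\<exists>s\<in>S. r s \<noteq> r' s) \<longrightarrow>
      decreasing_rearrangement (carrier G) (transition_prob G S r t \<one>\<^bsub>G\<^esub>) \<noteq>
      decreasing_rearrangement (carrier G) (transition_prob G S r' t \<one>\<^bsub>G\<^esub>))"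
proof -
  have "group G"
    using assms(1) by (auto simp: coxeter_system_def has_presentation_def)
  then interpret finite_coxeter_system G S
    using assms by (simp add: finite_coxeter_system_def finite_coxeter_system_axioms_def)
  show ?thesis
    using rates_majorization assms(3-6) by blast
qed

end
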